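(* The bracket $\{\,,\}$ on $L_{1;x}$ induces a cobracket on the graded dual $L_{1;x}^\vee$, $$d_{cy}: L_{1;x}^\vee\longrightarrow L_{1;x}^\vee\wedge L_{1;x}^\vee,$$ which, for every Lyndon word $W$, is given in terms of the dual basis by $$d_{cy}(T_{W^*}(x))=\sum_{U<V}\alpha^W_{U,V}\,T_{U^*}(x)\wedge T_{V^*}(x)+\sum_{U,V}\beta^W_{U,V}\,T_{U^*}(x)\wedge T_{V^*}(1)$$ and $$d_{cy}(T_{W^*}(1))=\sum_{U<V}\gamma^W_{U,V}\,T_{U^*}(1)\wedge T_{V^*}(1),$$ where $U$ and $V$ run over Lyndon words. In particular $d_{cy}^2=0$.
   Context: Words in the letters $0,1$ are ordered lexicographically with $0<1$. A Lyndon word is a nonempty word strictly smaller than all its proper nonempty right factors. Let $L=\mathrm{Lie}(X_0,X_1)$ be the free Lie algebra over $\mathbb{Q}$ (in the paper realized as rooted planar trivalent trees with leaves labelled $0,1$, with bracket given by grafting, modulo antisymmetry and Jacobi). Set $[0]=X_0$, $[1]=X_1$, and for a Lyndon word $W$ of length $\ge2$, $[W]=[[U],[V]]$ where $W=UV$ with $V$ the smallest nonempty proper right factor of $W$; the Lyndon brackets $[W]$ form a basis of $L$. For $f\in L$ let $D_f$ be the derivation of $L$ with $D_f(X_0)=0$, $D_f(X_1)=[X_1,f]$. Let $L_x,L_1$ be two copies of $L$ (trees with root decorated by $x$, resp. $1$), and write $f(x)$, $f(1)$ for the copies of $f\in L$. $L_{1;x}=L_1\oplus L_x$ carries the Lie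 bracket $$\{f(x),g(x)\}=[f,g](x),\quad \{f(1),g(1)\}=([f,g]+D_f(g)-D_g(f))(1),\quad \{f(x),g(1)\}=-\{g(1),f(x)\}=-(D_g(f))(x).$$ The structure coefficients are defined, for Lyndon words $U,V$, by $$\{[U](x),[V](x)\}=\sum_W\alpha^W_{U,V}[W](x)\ (U<V),\quad \{[U](x),[V](1)\}=\sum_W\beta^W_{U,V}[W](x)\ (U,V\text{ arbitrary}),\quad \{[U](1),[V](1)\}=\sum_W\gamma^W_{U,V}[W](1)\ (U<V).$$ $L_{1;x}^\vee$ is the graded dual of $L_{1;x}$ for the grading by length (number of letters). It has basis $T_{W^*}(x),T_{W^*}(1)$ ($W$ Lyndon), dual to the basis $[W](x),[W](1)$. The second exterior power of $L_{1;x}^\vee$ is identified with the graded dual of $L_{1;x}\wedge L_{1;x}$ so that exterior products of dual basis vectors are dual to exterior products of basis vectors; the induced cobracket is the transpose of $\{\,,\}:L_{1;x}\wedge L_{1;x}\to L_{1;x}$. The relation $d_{cy}^2=0$ refers to the extension of $d_{cy}$ to the exterior algebra by the graded Leibniz rule. *)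

theory Defs
  imports Complex_Main "HOL-Library.Poly_Mapping" "HOL-Library.Product_Plus"
    "HOL-Library.List_Lexorder" "HOL-Library.Sublist"
begin

hide_const (open) Poly_Mapping.range

section \<open>Vector spaces over the rationals\<close>

class rat_vector = ab_group_add +
  fixes scaleQ :: "rat \<Rightarrow> 'a \<Rightarrow> 'a" (infixr \<open>*\<^sub>Q\<close> 75)
  assumes scaleQ_add_right: "a *\<^sub>Q (x + y) = a *\<^sub>Q x + a *\<^sub>Q y"
    and scaleQ_add_left: "(a + b) *\<^sub>Q x = a *\<^sub>Q x + b *\<^sub>Q x"
    and scaleQ_scaleQ: "a *\<^sub>Q b *\<^sub>Q x = (a * b) *\<^sub>Q x"
    and scaleQ_one: "1 *\<^sub>Q x = x"

global_interpretation rv: vector_space "scaleQ :: rat \<Rightarrow> 'a \<Rightarrow> 'a::rat_vector"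
  by unfold_locales (simp_all add: scaleQ_add_right scaleQ_add_left scaleQ_scaleQ scaleQ_one)

global_interpretation rvp: vector_space_pair
  "scaleQ :: rat \<Rightarrow> 'a \<Rightarrow> 'a::rat_vector" "scaleQ :: rat \<Rightarrow> 'b \<Rightarrow> 'b::rat_vector"
  by unfold_locales

abbreviation linearQ :: "('a::rat_vector \<Rightarrow> 'b::rat_vector) \<Rightarrow> bool" where
  "linearQ \<equiv> Vector_Spaces.linear scaleQ scaleQ"

instantiation rat :: rat_vector
begin
definition scaleQ_rat :: "rat \<Rightarrow> rat \<Rightarrow> rat" where "scaleQ_rat = (*)"
instance by standard (simp_all add: scaleQ_rat_def algebra_simps)
end

instantiation prod :: (rat_vector, rat_vector) rat_vector
begin
definition scaleQ_prod :: "rat \<Rightarrow> 'a \<times> 'b \<Rightarrow> 'a \<times> 'b" where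
  "scaleQ_prod c v = (c *\<^sub>Q fst v, c *\<^sub>Q snd v)"
instance
  by standard
    (simp_all add: scaleQ_prod_def prod_eq_iff scaleQ_add_right scaleQ_add_left scaleQ_scaleQ scaleQ_one)
end

instantiation poly_mapping :: (type, rat_vector) rat_vector
begin
lift_definition scaleQ_poly_mapping :: "rat \<Rightarrow> ('a \<Rightarrow>\<^sub>0 'b) \<Rightarrow> ('a \<Rightarrow>\<^sub>0 'b)"
  is "\<lambda>c f k. c *\<^sub>Q f k"
  by (rule finite_subset) (auto simp: rv.scale_eq_0_iff)
instance
  by standard
    (transfer; simp add: scaleQ_add_right scaleQ_add_left scaleQ_scaleQ scaleQ_one)+
end

lemma lookup_scaleQ [simp]:
  "Poly_Mapping.lookup (c *\<^sub>Q p) k = c *\<^sub>Q Poly_Mapping.lookup p k"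
  by transfer simp

text \<open>
  \<^typ>\<open>'a \<Rightarrow>\<^sub>0 rat\<close> serves as the free rational vector space on the set \<^typ>\<open>'a\<close>;
  \<open>lin_ext f\<close> is the linear map sending each generator \<open>a\<close> to \<open>f a\<close>, and \<open>bilin_ext op\<close>
  the bilinear map extending a binary operation on generators.
\<close>

abbreviation gen :: "'a \<Rightarrow> ('a \<Rightarrow>\<^sub>0 rat)" where
  "gen a \<equiv> Poly_Mapping.single a 1"

definition lin_ext :: "('a \<Rightarrow> 'b::rat_vector) \<Rightarrow> ('a \<Rightarrow>\<^sub>0 rat) \<Rightarrow> 'b" where
  "lin_ext f p = (\<Sum>k\<in>Poly_Mapping.keys p. Poly_Mapping.lookup p k *\<^sub>Q f k)"

definition bilin_ext ::
  "('a \<Rightarrow> 'b \<Rightarrow> 'c) \<Rightarrow> ('a \<Rightarrow>\<^sub>0 rat) \<Rightarrow> ('b \<Rightarrow>\<^sub>0 rat) \<Rightarrow> ('c \<Rightarrow>\<^sub>0 rat)" where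
  "bilin_ext op p q = lin_ext (\<lambda>a. lin_ext (\<lambda>b. gen (op a b)) q) p"

lemma lin_ext_superset:
  assumes "finite A" "Poly_Mapping.keys p \<subseteq> A"
  shows "lin_ext f p = (\<Sum>k\<in>A. Poly_Mapping.lookup p k *\<^sub>Q f k)"
  unfolding lin_ext_def
  by (rule sum.mono_neutral_left) (use assms in \<open>auto simp: in_keys_iff\<close>)

lemma lin_ext_gen [simp]: "lin_ext f (gen a) = f a"
  by (simp add: lin_ext_def scaleQ_one)

lemma lin_ext_add: "lin_ext f (p + q) = lin_ext f p + lin_ext f q"
proof -
  let ?A = "Poly_Mapping.keys p \<union> Poly_Mapping.keys q"
  have "lin_ext f (p + q) = (\<Sum>k\<in>?A. Poly_Mapping.lookup (p + q) k *\<^sub>Q f k)"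
    by (rule lin_ext_superset) (auto simp: in_keys_iff lookup_add)
  moreover have "lin_ext f p = (\<Sum>k\<in>?A. Poly_Mapping.lookup p k *\<^sub>Q f k)"
    "lin_ext f q = (\<Sum>k\<in>?A. Poly_Mapping.lookup q k *\<^sub>Q f k)"
    by (rule lin_ext_superset; auto)+
  ultimately show ?thesis
    by (simp add: lookup_add scaleQ_add_left sum.distrib)
qed

lemma lin_ext_scale: "lin_ext f (c *\<^sub>Q p) = c *\<^sub>Q lin_ext f p"
proof -
  have "lin_ext f (c *\<^sub>Q p)
      = (\<Sum>k\<in>Poly_Mapping.keys p. Poly_Mapping.lookup (c *\<^sub>Q p) k *\<^sub>Q f k)"
    by (rule lin_ext_superset) (auto simp: in_keys_iff rv.scale_eq_0_iff)
  then show ?thesis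
    by (simp add: lin_ext_def rv.scale_sum_right scaleQ_rat_def scaleQ_scaleQ)
qed

lemma linear_lin_ext: "linearQ (lin_ext f)"
  by (rule Vector_Spaces.linear_iff[THEN iffD2])
    (auto simp: lin_ext_add lin_ext_scale rv.vector_space_axioms)

lemma gen_induct [case_names gen add scale]:
  assumes gen: "\<And>a. P (gen a)"
    and add: "\<And>p q. P p \<Longrightarrow> P q \<Longrightarrow> P (p + q)"
    and scale: "\<And>c p. P p \<Longrightarrow> P (c *\<^sub>Q p)"
  shows "P p"
proof -
  have zero: "P 0"
    using scale[OF gen, of 0 undefined] by simp
  have P_sum: "P (\<Sum>k\<in>A. g k)" if "finite A" "\<And>k. P (g k)" for A :: "'a set" and g
    using that by (induction A rule: finite_induct) (simp_all add: zero add)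
  have "p = (\<Sum>k\<in>Poly_Mapping.keys p. Poly_Mapping.lookup p k *\<^sub>Q gen k)"
  proof (rule poly_mapping_eqI)
    fix k
    have "(\<Sum>x\<in>Poly_Mapping.keys p. Poly_Mapping.lookup p x * (if x = k then 1 else 0))
        = (\<Sum>x\<in>Poly_Mapping.keys p. if x = k then Poly_Mapping.lookup p x else 0)"
      by (rule sum.cong) auto
    then show "Poly_Mapping.lookup p k =
        Poly_Mapping.lookup (\<Sum>k\<in>Poly_Mapping.keys p. Poly_Mapping.lookup p k *\<^sub>Q gen k) k"
      by (simp add: lookup_sum lookup_single scaleQ_rat_def when_def in_keys_iff)
  qed
  moreover have "P (\<Sum>k\<in>Poly_Mapping.keys p. Poly_Mapping.lookup p k *\<^sub>Q gen k)"
    by (rule P_sum) (auto intro: gen scale)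
  ultimately show ?thesis
    by simp
qed

lemma lin_ext_fun_add: "lin_ext (\<lambda>a. f a + g a) p = lin_ext f p + lin_ext g p"
  by (simp add: lin_ext_def scaleQ_add_right sum.distrib)

lemma lin_ext_fun_scale: "lin_ext (\<lambda>a. c *\<^sub>Q f a) p = c *\<^sub>Q lin_ext f p"
  by (simp add: lin_ext_def rv.scale_sum_right scaleQ_scaleQ mult.commute)

lemma bilin_ext_gen [simp]: "bilin_ext op (gen a) (gen b) = gen (op a b)"
  and bilin_ext_add_left: "bilin_ext op (p + p') q = bilin_ext op p q + bilin_ext op p' q"
  and bilin_ext_add_right: "bilin_ext op p (q + q') = bilin_ext op p q + bilin_ext op p q'"
  and bilin_ext_scale_left: "bilin_ext op (c *\<^sub>Q p) q = c *\<^sub>Q bilin_ext op p q"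
  and bilin_ext_scale_right: "bilin_ext op p (c *\<^sub>Q q) = c *\<^sub>Q bilin_ext op p q"
  by (simp_all add: bilin_ext_def lin_ext_add lin_ext_scale lin_ext_fun_add lin_ext_fun_scale)

lemma bilin_ext_diff:
  "bilin_ext op p q - bilin_ext op p' q'
    = bilin_ext op (p - p') q + bilin_ext op p' (q - q')"
  using bilin_ext_add_left[of op "p - p'" p' q] bilin_ext_add_right[of op p' "q - q'" q']
  by simp

lemma diff_diff_diff: "p - q - (p' - q') = (p - p') + - (q - (q' :: 'a::ab_group_add))"
  by simp

section \<open>Lyndon words\<close>

text \<open>The letters 0 and 1 are \<^term>\<open>False\<close> and \<^term>\<open>True\<close>; the order on words is
  the lexicographic one of \<^theory>\<open>HOL-Library.List_Lexorder\<close>, for which a proper prefix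
  is smaller.\<close>

type_synonym word = "bool list"

definition lyndon :: "word \<Rightarrow> bool" where
  "lyndon W \<longleftrightarrow> W \<noteq> [] \<and> (\<forall>V. V \<noteq> [] \<and> strict_suffix V W \<longrightarrow> W < V)"

definition min_right_factor :: "word \<Rightarrow> word" where
  "min_right_factor W = Min {V. V \<noteq> [] \<and> strict_suffix V W}"

definition left_cofactor :: "word \<Rightarrow> word" where
  "left_cofactor W = take (length W - length (min_right_factor W)) W"

lemma min_right_factor:
  assumes "2 \<le> length W"
  shows "min_right_factor W \<noteq> []" "strict_suffix (min_right_factor W) W"
proof -
  let ?S = "{V. V \<noteq> [] \<and> strict_suffix V W}"
  have "finite ?S"
    by (rule finite_subset[of _ "set (suffixes W)"]) (auto simp: strict_suffix_def)
  moreover have "tl W \<in> ?S"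
    using assms by (cases W) (auto simp: strict_suffix_def suffix_def)
  ultimately have "min_right_factor W \<in> ?S"
    unfolding min_right_factor_def by (metis Min_in empty_iff)
  then show "min_right_factor W \<noteq> []" "strict_suffix (min_right_factor W) W"
    by auto
qed

lemma left_cofactor_append:
  assumes "2 \<le> length W"
  shows "left_cofactor W @ min_right_factor W = W"
proof -
  obtain zs where zs: "W = zs @ min_right_factor W"
    using min_right_factor(2)[OF assms] by (auto simp: strict_suffix_def suffix_def)
  have "length W = length zs + length (min_right_factor W)"
    using zs by (metis length_append)
  then have "left_cofactor W = take (length zs) W"
    by (simp add: left_cofactor_def)
  also have "\<dots> = zs"
    using zs by (metis append_eq_conv_conj)
  finally show ?thesis
    using zs by simp
qed

section \<open>The free Lie algebra on two generators\<close>

datatype tree = Leaf bool | Node tree tree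

fun leaves :: "tree \<Rightarrow> nat" where
  "leaves (Leaf b) = 1"
| "leaves (Node s t) = leaves s + leaves t"

text \<open>The ideal, for the grafting product, generated by antisymmetry and Jacobi.\<close>

inductive_set lie_ideal :: "(tree \<Rightarrow>\<^sub>0 rat) set" where
  antisymmetry: "gen (Node s t) + gen (Node t s) \<in> lie_ideal"
| jacobi: "gen (Node r (Node s t)) + gen (Node s (Node t r)) + gen (Node t (Node r s)) \<in> lie_ideal"
| add: "p \<in> lie_ideal \<Longrightarrow> q \<in> lie_ideal \<Longrightarrow> p + q \<in> lie_ideal"
| scale: "p \<in> lie_ideal \<Longrightarrow> c *\<^sub>Q p \<in> lie_ideal"
| graft_right: "p \<in> lie_ideal \<Longrightarrow> bilin_ext Node p q \<in> lie_ideal"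
| graft_left: "p \<in> lie_ideal \<Longrightarrow> bilin_ext Node q p \<in> lie_ideal"

lemma lie_ideal_zero: "0 \<in> lie_ideal"
  using lie_ideal.scale[OF lie_ideal.antisymmetry, of 0] by simp

lemma lie_ideal_uminus: "p \<in> lie_ideal \<Longrightarrow> - p \<in> lie_ideal"
  using lie_ideal.scale[of p "- 1"] by simp

definition lie_equiv :: "(tree \<Rightarrow>\<^sub>0 rat) \<Rightarrow> (tree \<Rightarrow>\<^sub>0 rat) \<Rightarrow> bool" where
  "lie_equiv p q \<longleftrightarrow> p - q \<in> lie_ideal"

lemma equivp_lie_equiv: "equivp lie_equiv"
proof (rule equivpI)
  show "reflp lie_equiv"
    by (simp add: reflp_def lie_equiv_def lie_ideal_zero)
  show "symp lie_equiv"
    unfolding symp_def lie_equiv_def by (metis lie_ideal_uminus minus_diff_eq)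
  show "transp lie_equiv"
    unfolding transp_def lie_equiv_def using lie_ideal.add by fastforce
qed

quotient_type lie = "tree \<Rightarrow>\<^sub>0 rat" / lie_equiv
  by (rule equivp_lie_equiv)

instantiation lie :: rat_vector
begin
lift_definition zero_lie :: lie is 0 .
lift_definition plus_lie :: "lie \<Rightarrow> lie \<Rightarrow> lie" is "(+)"
  unfolding lie_equiv_def by (metis add_diff_add lie_ideal.add)
lift_definition uminus_lie :: "lie \<Rightarrow> lie" is uminus
  unfolding lie_equiv_def by (metis lie_ideal_uminus minus_diff_minus)
lift_definition minus_lie :: "lie \<Rightarrow> lie \<Rightarrow> lie" is "(-)"
  unfolding lie_equiv_def diff_diff_diff
  by (intro lie_ideal.add lie_ideal_uminus)
lift_definition scaleQ_lie :: "rat \<Rightarrow> lie \<Rightarrow> lie" is scaleQ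
  unfolding lie_equiv_def by (metis lie_ideal.scale rv.scale_right_diff_distrib)
instance
  by standard
    (transfer; simp add: lie_equiv_def lie_ideal_zero scaleQ_add_right scaleQ_add_left
      scaleQ_scaleQ scaleQ_one algebra_simps)+
end

lift_definition lie_of_tree :: "tree \<Rightarrow> lie" is gen .

lift_definition lie_bracket :: "lie \<Rightarrow> lie \<Rightarrow> lie" is "bilin_ext Node"
  unfolding lie_equiv_def bilin_ext_diff
  by (intro lie_ideal.add lie_ideal.graft_right lie_ideal.graft_left)

abbreviation X0 :: lie where "X0 \<equiv> lie_of_tree (Leaf False)"
abbreviation X1 :: lie where "X1 \<equiv> lie_of_tree (Leaf True)"

definition lie_grade :: "nat \<Rightarrow> lie set" where
  "lie_grade n = rv.span {lie_of_tree t | t. leaves t = n}"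

definition lie_derivation :: "(lie \<Rightarrow> lie) \<Rightarrow> bool" where
  "lie_derivation D \<longleftrightarrow> linearQ D \<and>
    (\<forall>f g. D (lie_bracket f g) = lie_bracket (D f) g + lie_bracket f (D g))"

definition der :: "lie \<Rightarrow> lie \<Rightarrow> lie" where
  "der f = (THE D. lie_derivation D \<and> D X0 = 0 \<and> D X1 = lie_bracket X1 f)"

text \<open>The value at the empty word is a dummy.\<close>

function lyndon_bracket :: "word \<Rightarrow> lie" where
  "lyndon_bracket W =
    (if W = [] then 0
     else if length W = 1 then lie_of_tree (Leaf (hd W))
     else lie_bracket (lyndon_bracket (left_cofactor W)) (lyndon_bracket (min_right_factor W)))"
  by auto
termination
proof (relation "measure length")
  fix W :: word
  assume "W \<noteq> []" "length W \<noteq> 1"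
  then have W: "2 \<le> length W"
    by (cases W) (auto simp: Suc_le_eq)
  have "length (left_cofactor W) + length (min_right_factor W) = length W"
    using left_cofactor_append[OF W] by (metis length_append)
  moreover have "length (min_right_factor W) < length W"
    using min_right_factor(2)[OF W] by (rule suffix_length_less)
  moreover have "0 < length (min_right_factor W)"
    using min_right_factor(1)[OF W] by simp
  ultimately have "length (left_cofactor W) < length W" "length (min_right_factor W) < length W"
    by linarith+
  then show "(left_cofactor W, W) \<in> measure length"
    "(min_right_factor W, W) \<in> measure length"
    by simp_all
qed simp

declare lyndon_bracket.simps [simp del]

section \<open>The Lie algebra \<open>L_{1;x}\<close>\<close>

text \<open>The first component is \<open>L_1\<close>, the second \<open>L_x\<close>.\<close>

type_synonym lie_1x = "lie \<times> lie"

definition at_x :: "lie \<Rightarrow> lie_1x" where "at_x f = (0, f)"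
definition at_1 :: "lie \<Rightarrow> lie_1x" where "at_1 f = (f, 0)"

text \<open>The bilinear extension of the three defining formulas: for
  \<open>u = a(1) + f(x)\<close> and \<open>v = b(1) + g(x)\<close>, the mixed terms are
  \<open>{a(1), g(x)} = (D_a g)(x)\<close> and \<open>{f(x), b(1)} = - (D_b f)(x)\<close>.\<close>

fun bracket_1x :: "lie_1x \<Rightarrow> lie_1x \<Rightarrow> lie_1x" where
  "bracket_1x (a, f) (b, g) =
    (lie_bracket a b + der a b - der b a, lie_bracket f g + der a g - der b f)"

definition grade_1x :: "nat \<Rightarrow> lie_1x set" where
  "grade_1x n = lie_grade n \<times> lie_grade n"

text \<open>Structure coefficients: the coefficient of \<open>[W](x)\<close>, resp. \<open>[W](1)\<close>, of a bracket in the
  Lyndon basis of \<open>L_x\<close>, resp. \<open>L_1\<close>; upper index first.  That the Lyndon brackets form a basis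
  is not built into the definitions.\<close>

definition alpha :: "word \<Rightarrow> word \<Rightarrow> word \<Rightarrow> rat" where
  "alpha W U V =
    rv.representation {at_x (lyndon_bracket W') | W'. lyndon W'}
      (bracket_1x (at_x (lyndon_bracket U)) (at_x (lyndon_bracket V)))
      (at_x (lyndon_bracket W))"

definition beta :: "word \<Rightarrow> word \<Rightarrow> word \<Rightarrow> rat" where
  "beta W U V =
    rv.representation {at_x (lyndon_bracket W') | W'. lyndon W'}
      (bracket_1x (at_x (lyndon_bracket U)) (at_1 (lyndon_bracket V)))
      (at_x (lyndon_bracket W))"

definition gamma :: "word \<Rightarrow> word \<Rightarrow> word \<Rightarrow> rat" where
  "gamma W U V =
    rv.representation {at_1 (lyndon_bracket W') | W'. lyndon W'}
      (bracket_1x (at_1 (lyndon_bracket U)) (at_1 (lyndon_bracket V)))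
      (at_1 (lyndon_bracket W))"

section \<open>The graded dual\<close>

typedef dual_1x = "{\<phi> :: lie_1x \<Rightarrow> rat. linearQ \<phi> \<and> finite {n. \<exists>v\<in>grade_1x n. \<phi> v \<noteq> 0}}"
  morphisms app_dual Abs_dual_1x
  by (rule exI[of _ "\<lambda>_. 0"]) (simp add: rvp.linear_zero)

setup_lifting type_definition_dual_1x

instantiation dual_1x :: rat_vector
begin
lift_definition zero_dual_1x :: dual_1x is "\<lambda>_. 0"
  by (simp add: rvp.linear_zero)
lift_definition plus_dual_1x :: "dual_1x \<Rightarrow> dual_1x \<Rightarrow> dual_1x" is "\<lambda>\<phi> \<psi> v. \<phi> v + \<psi> v"
proof
  fix \<phi> \<psi> :: "lie_1x \<Rightarrow> rat"
  assume *: "linearQ \<phi> \<and> finite {n. \<exists>v\<in>grade_1x n. \<phi> v \<noteq> 0}"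
    "linearQ \<psi> \<and> finite {n. \<exists>v\<in>grade_1x n. \<psi> v \<noteq> 0}"
  show "linearQ (\<lambda>v. \<phi> v + \<psi> v)"
    using * by (simp add: rvp.linear_compose_add)
  show "finite {n. \<exists>v\<in>grade_1x n. \<phi> v + \<psi> v \<noteq> 0}"
    by (rule finite_subset[of _ "{n. \<exists>v\<in>grade_1x n. \<phi> v \<noteq> 0} \<union> {n. \<exists>v\<in>grade_1x n. \<psi> v \<noteq> 0}"])
      (use * in auto)
qed
lift_definition scaleQ_dual_1x :: "rat \<Rightarrow> dual_1x \<Rightarrow> dual_1x" is "\<lambda>c \<phi> v. c *\<^sub>Q \<phi> v"
proof
  fix c and \<phi> :: "lie_1x \<Rightarrow> rat"
  assume *: "linearQ \<phi> \<and> finite {n. \<exists>v\<in>grade_1x n. \<phi> v \<noteq> 0}"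
  show "linearQ (\<lambda>v. c *\<^sub>Q \<phi> v)"
    using * by (simp add: rvp.linear_compose_scale_right)
  show "finite {n. \<exists>v\<in>grade_1x n. c *\<^sub>Q \<phi> v \<noteq> 0}"
    by (rule finite_subset[of _ "{n. \<exists>v\<in>grade_1x n. \<phi> v \<noteq> 0}"])
      (use * in \<open>auto simp: rv.scale_eq_0_iff\<close>)
qed
definition uminus_dual_1x :: "dual_1x \<Rightarrow> dual_1x" where "- \<phi> = (- 1) *\<^sub>Q \<phi>" for \<phi> :: dual_1x
definition minus_dual_1x :: "dual_1x \<Rightarrow> dual_1x \<Rightarrow> dual_1x" where "\<phi> - \<psi> = \<phi> + - \<psi>" for \<phi> \<psi> :: dual_1x
instance
  by standard
    (simp_all add: app_dual_inject[symmetric] fun_eq_iff uminus_dual_1x_def minus_dual_1x_def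
      plus_dual_1x.rep_eq zero_dual_1x.rep_eq scaleQ_dual_1x.rep_eq scaleQ_rat_def algebra_simps)
end

definition T_x :: "word \<Rightarrow> dual_1x" where
  "T_x W = (THE \<phi>. \<forall>V. lyndon V \<longrightarrow>
    app_dual \<phi> (at_x (lyndon_bracket V)) = of_bool (V = W) \<and>
    app_dual \<phi> (at_1 (lyndon_bracket V)) = 0)"

definition T_1 :: "word \<Rightarrow> dual_1x" where
  "T_1 W = (THE \<phi>. \<forall>V. lyndon V \<longrightarrow>
    app_dual \<phi> (at_1 (lyndon_bracket V)) = of_bool (V = W) \<and>
    app_dual \<phi> (at_x (lyndon_bracket V)) = 0)"

section \<open>Exterior algebras\<close>

text \<open>The exterior algebra of \<open>V\<close> as the free associative algebra on the set \<open>V\<close> (with basis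
  the lists, multiplied by concatenation) modulo the two-sided ideal generated by the linear
  relations of \<open>V\<close>, which cut it down to the tensor algebra, and the squares of elements of \<open>V\<close>.\<close>

inductive_set ext_ideal :: "('v::rat_vector list \<Rightarrow>\<^sub>0 rat) set" where
  gen_add: "gen [x + y] - (gen [x] + gen [y]) \<in> ext_ideal"
| gen_scale: "gen [c *\<^sub>Q x] - c *\<^sub>Q gen [x] \<in> ext_ideal"
| square: "gen [x, x] \<in> ext_ideal"
| add: "p \<in> ext_ideal \<Longrightarrow> q \<in> ext_ideal \<Longrightarrow> p + q \<in> ext_ideal"
| scale: "p \<in> ext_ideal \<Longrightarrow> c *\<^sub>Q p \<in> ext_ideal"
| mult_right: "p \<in> ext_ideal \<Longrightarrow> bilin_ext (@) p q \<in> ext_ideal"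
| mult_left: "p \<in> ext_ideal \<Longrightarrow> bilin_ext (@) q p \<in> ext_ideal"

lemma ext_ideal_zero: "0 \<in> ext_ideal"
  using ext_ideal.scale[OF ext_ideal.square, of 0] by simp

lemma ext_ideal_uminus: "p \<in> ext_ideal \<Longrightarrow> - p \<in> ext_ideal"
  using ext_ideal.scale[of p "- 1"] by simp

definition ext_equiv :: "('v::rat_vector list \<Rightarrow>\<^sub>0 rat) \<Rightarrow> ('v list \<Rightarrow>\<^sub>0 rat) \<Rightarrow> bool" where
  "ext_equiv p q \<longleftrightarrow> p - q \<in> ext_ideal"

lemma equivp_ext_equiv: "equivp ext_equiv"
proof (rule equivpI)
  show "reflp ext_equiv"
    by (simp add: reflp_def ext_equiv_def ext_ideal_zero)
  show "symp ext_equiv"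
    unfolding symp_def ext_equiv_def by (metis ext_ideal_uminus minus_diff_eq)
  show "transp ext_equiv"
    unfolding transp_def ext_equiv_def using ext_ideal.add by fastforce
qed

quotient_type (overloaded) 'v ext = "'v::rat_vector list \<Rightarrow>\<^sub>0 rat" / ext_equiv
  by (rule equivp_ext_equiv)

instantiation ext :: (rat_vector) rat_vector
begin
lift_definition zero_ext :: "'a ext" is 0 .
lift_definition plus_ext :: "'a ext \<Rightarrow> 'a ext \<Rightarrow> 'a ext" is "(+)"
  unfolding ext_equiv_def by (metis add_diff_add ext_ideal.add)
lift_definition uminus_ext :: "'a ext \<Rightarrow> 'a ext" is uminus
  unfolding ext_equiv_def by (metis ext_ideal_uminus minus_diff_minus)
lift_definition minus_ext :: "'a ext \<Rightarrow> 'a ext \<Rightarrow> 'a ext" is "(-)"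
  unfolding ext_equiv_def diff_diff_diff
  by (intro ext_ideal.add ext_ideal_uminus)
lift_definition scaleQ_ext :: "rat \<Rightarrow> 'a ext \<Rightarrow> 'a ext" is scaleQ
  unfolding ext_equiv_def by (metis ext_ideal.scale rv.scale_right_diff_distrib)
instance
  by standard
    (transfer; simp add: ext_equiv_def ext_ideal_zero scaleQ_add_right scaleQ_add_left
      scaleQ_scaleQ scaleQ_one algebra_simps)+
end

lift_definition ext_of_list :: "'v::rat_vector list \<Rightarrow> 'v ext" is gen .

lift_definition wedge :: "'v::rat_vector ext \<Rightarrow> 'v ext \<Rightarrow> 'v ext" (infixr \<open>\<and>\<^sub>E\<close> 70)
  is "bilin_ext (@)"
  unfolding ext_equiv_def bilin_ext_diff
  by (intro ext_ideal.add ext_ideal.mult_right ext_ideal.mult_left)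

definition ext_incl :: "'v::rat_vector \<Rightarrow> 'v ext" where
  "ext_incl x = ext_of_list [x]"

definition ext_power :: "nat \<Rightarrow> 'v::rat_vector ext set" where
  "ext_power p = rv.span {ext_of_list xs | xs. length xs = p}"

section \<open>The cobracket\<close>

lemma lin_ext_minus: "lin_ext f (- p) = - lin_ext f p"
  using lin_ext_scale[of f "- 1" p] by simp

lemma lin_ext_diff: "lin_ext f (p - q) = lin_ext f p - lin_ext f q"
  using lin_ext_add[of f p "- q"] by (simp add: lin_ext_minus)

text \<open>The pairing of \<open>\<phi> \<and> \<psi>\<close> with \<open>u \<and> v\<close> is the determinant \<open>\<phi>(u) \<psi>(v) - \<phi>(v) \<psi>(u)\<close>, so that
  wedges of dual basis vectors are dual to wedges of basis vectors; components of exterior degree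
  other than 2 pair to 0.\<close>

fun pair_list :: "dual_1x list \<Rightarrow> lie_1x \<Rightarrow> lie_1x \<Rightarrow> rat" where
  "pair_list [\<phi>, \<psi>] u v = app_dual \<phi> u * app_dual \<psi> v - app_dual \<phi> v * app_dual \<psi> u"
| "pair_list _ u v = 0"

fun pair_list0 :: "dual_1x list \<Rightarrow> rat" where
  "pair_list0 [] = 1"
| "pair_list0 _ = 0"

fun pair_list1 :: "dual_1x list \<Rightarrow> lie_1x \<Rightarrow> rat" where
  "pair_list1 [\<phi>] u = app_dual \<phi> u"
| "pair_list1 _ u = 0"

lemma pair_list_append:
  "pair_list0 (xs @ ys) = pair_list0 xs * pair_list0 ys"
  "pair_list1 (xs @ ys) u = pair_list0 xs * pair_list1 ys u + pair_list1 xs u * pair_list0 ys"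
  "pair_list (xs @ ys) u v = pair_list0 xs * pair_list ys u v + pair_list xs u v * pair_list0 ys
    + pair_list1 xs u * pair_list1 ys v - pair_list1 xs v * pair_list1 ys u"
  by (cases "(xs, u, v)" rule: pair_list.cases; cases "(ys, u, v)" rule: pair_list.cases; simp)+

lemma lin_ext_pair_list:
  "lin_ext pair_list0 (bilin_ext (@) p q) = lin_ext pair_list0 p * lin_ext pair_list0 q"
  "lin_ext (\<lambda>xs. pair_list1 xs u) (bilin_ext (@) p q)
    = lin_ext pair_list0 p * lin_ext (\<lambda>xs. pair_list1 xs u) q
      + lin_ext (\<lambda>xs. pair_list1 xs u) p * lin_ext pair_list0 q"
  "lin_ext (\<lambda>xs. pair_list xs u v) (bilin_ext (@) p q)
    = lin_ext pair_list0 p * lin_ext (\<lambda>xs. pair_list xs u v) q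
      + lin_ext (\<lambda>xs. pair_list xs u v) p * lin_ext pair_list0 q
      + lin_ext (\<lambda>xs. pair_list1 xs u) p * lin_ext (\<lambda>xs. pair_list1 xs v) q
      - lin_ext (\<lambda>xs. pair_list1 xs v) p * lin_ext (\<lambda>xs. pair_list1 xs u) q"
proof -
  note lins = lin_ext_add lin_ext_scale bilin_ext_add_left bilin_ext_add_right
    bilin_ext_scale_left bilin_ext_scale_right
  let ?P0 = "lin_ext pair_list0"
  let ?P1 = "\<lambda>u. lin_ext (\<lambda>xs. pair_list1 xs u)"
  let ?P2 = "lin_ext (\<lambda>xs. pair_list xs u v)"
  show "?P0 (bilin_ext (@) p q) = ?P0 p * ?P0 q"
  proof (induction p rule: gen_induct)
    case (gen xs)
    show ?case
      by (induction q rule: gen_induct)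
        (simp_all add: lins scaleQ_rat_def pair_list_append algebra_simps)
  qed (simp_all add: lins scaleQ_rat_def algebra_simps)
  show "?P1 u (bilin_ext (@) p q) = ?P0 p * ?P1 u q + ?P1 u p * ?P0 q"
  proof (induction p rule: gen_induct)
    case (gen xs)
    show ?case
      by (induction q rule: gen_induct)
        (simp_all add: lins scaleQ_rat_def pair_list_append algebra_simps)
  qed (simp_all add: lins scaleQ_rat_def algebra_simps)
  show "?P2 (bilin_ext (@) p q)
    = ?P0 p * ?P2 q + ?P2 p * ?P0 q + ?P1 u p * ?P1 v q - ?P1 v p * ?P1 u q"
  proof (induction p rule: gen_induct)
    case (gen xs)
    show ?case
      by (induction q rule: gen_induct)
        (simp add: pair_list_append, (simp only: lins scaleQ_rat_def, simp add: algebra_simps)+)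
  qed (simp only: lins scaleQ_rat_def, simp add: algebra_simps)+
qed

lemma lin_ext_pair_list_ideal:
  assumes "p \<in> ext_ideal"
  shows "lin_ext pair_list0 p = 0 \<and> (\<forall>u. lin_ext (\<lambda>xs. pair_list1 xs u) p = 0) \<and>
    (\<forall>u v. lin_ext (\<lambda>xs. pair_list xs u v) p = 0)"
  using assms
  by (induction rule: ext_ideal.induct)
    (simp_all add: lin_ext_pair_list lin_ext_add lin_ext_diff lin_ext_scale
      plus_dual_1x.rep_eq scaleQ_dual_1x.rep_eq)

lift_definition ext_pair :: "dual_1x ext \<Rightarrow> lie_1x \<Rightarrow> lie_1x \<Rightarrow> rat"
  is "\<lambda>p u v. lin_ext (\<lambda>xs. pair_list xs u v) p"
proof -
  fix p q :: "dual_1x list \<Rightarrow>\<^sub>0 rat"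
  assume "ext_equiv p q"
  then have "lin_ext (\<lambda>xs. pair_list xs u v) (p - q) = 0" for u v
    using lin_ext_pair_list_ideal unfolding ext_equiv_def by blast
  then show "(\<lambda>u v. lin_ext (\<lambda>xs. pair_list xs u v) p) = (\<lambda>u v. lin_ext (\<lambda>xs. pair_list xs u v) q)"
    by (simp add: lin_ext_diff)
qed

text \<open>\<open>\<omega>\<close> is the image of \<open>\<phi>\<close> under the transpose of \<open>{ , }: L_{1;x} \<and> L_{1;x} \<rightarrow> L_{1;x}\<close>.\<close>

definition is_cobracket :: "dual_1x \<Rightarrow> dual_1x ext \<Rightarrow> bool" where
  "is_cobracket \<phi> \<omega> \<longleftrightarrow>
    \<omega> \<in> ext_power 2 \<and> (\<forall>u v. ext_pair \<omega> u v = app_dual \<phi> (bracket_1x u v))"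

definition d_cy :: "dual_1x \<Rightarrow> dual_1x ext" where
  "d_cy \<phi> = (THE \<omega>. is_cobracket \<phi> \<omega>)"

definition leibniz_extension ::
  "('v::rat_vector \<Rightarrow> 'v ext) \<Rightarrow> ('v ext \<Rightarrow> 'v ext) \<Rightarrow> bool" where
  "leibniz_extension \<delta> d \<longleftrightarrow> linearQ d \<and> (\<forall>x. d (ext_incl x) = \<delta> x) \<and>
    (\<forall>p. \<forall>a\<in>ext_power p. \<forall>b. d (a \<and>\<^sub>E b) = (d a \<and>\<^sub>E b) + (- 1) ^ p *\<^sub>Q (a \<and>\<^sub>E d b))"

end

theory Submission
  imports Defs
begin

text \<open>
  A functional in the graded dual vanishes in large weights, and the bracket adds weights, so the
  transpose of the bracket takes its values in the exterior square of the graded dual as soon as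
  each weight is finite dimensional with a known dual basis. Everything therefore rests on the
  Lyndon basis, and then on two identities: the determinant pairing identifies the exterior square
  with a space of alternating matrices, and the Jacobi identity of \<open>L_{1;x}\<close> is the relation
  \<open>d_cy\<^sup>2 = 0\<close>.

  \<^bold>\<open>Lyndon basis.\<close> The Lyndon brackets span because a bracket \<open>[[l], [m]]\<close> with \<open>l < m\<close> can be
  rewritten by the Jacobi identity into Lyndon brackets of words smaller than \<open>m\<close>
  (\<open>lyndon_bracket_rewrite\<close>). They are independent because in the free associative algebra \<open>[W]\<close>
  expands as \<open>W\<close> plus larger words of the same length (\<open>assoc_of_lyndon_bracket\<close>).

  \<^bold>\<open>The bracket.\<close> The derivations \<open>D_f\<close> exist since the free Lie algebra is free, and
  \<open>D\<close> turns the first component of the bracket into the commutator of derivations (\<open>der_ihara\<close>).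
  So \<open>L_{1;x}\<close> is a semidirect product, and its Jacobi identity (\<open>bracket_1x_jacobi\<close>) follows from
  the one of the free Lie algebra.

  \<^bold>\<open>The cobracket.\<close> Write \<open>b\<^sub>i\<close> for the Lyndon basis of \<open>L_{1;x}\<close> and \<open>e\<^sub>i\<close> for the dual basis.
  An element of the exterior square equals half the sum of \<open>e\<^sub>i \<and> e\<^sub>j\<close> with its pairings with
  \<open>(b\<^sub>i, b\<^sub>j)\<close> as coefficients, over all indices up to any sufficiently large weight (\<open>ext_power_2_expansion\<close>); hence
  at most one element has prescribed pairings, and the same formula produces \<open>d_cy \<phi>\<close>
  (\<open>is_cobracket_wedge_form\<close>). For \<open>\<phi> = e\<^sub>k\<close> the pairings are the structure coefficients, and
  sorting the pairs of indices gives the stated formulas.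

  \<^bold>\<open>The differential.\<close> A linear map from a vector space into its exterior square extends to
  exactly one antiderivation, and that antiderivation squares to zero as soon as it does so on
  generators (\<open>leibniz_extension_square_zero\<close>). On a generator \<open>\<phi>\<close>, two applications of the
  expansion give half the sum of \<open>\<phi>({{b\<^sub>k, b\<^sub>l}, b\<^sub>j})\<close> times \<open>e\<^sub>k \<and> e\<^sub>l \<and> e\<^sub>j\<close>. The wedge is invariant
  under cyclic permutation, so three times this sum is a sum of Jacobi expressions
  (\<open>d_cy_square_zero\<close>).
\<close>

section \<open>Lyndon words and their standard factorization\<close>

lemma append_less_append_iff [simp]: "(u::word) @ x < u @ y \<longleftrightarrow> x < y"
  by (induction u) auto

lemma less_append_append:
  "(u::word) < v \<Longrightarrow> \<not> prefix u v \<Longrightarrow> u @ x < v @ y"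
proof (induction u arbitrary: v)
  case (Cons a u)
  then show ?case by (cases v) auto
qed auto

lemma prefix_imp_le: "prefix (u::word) v \<Longrightarrow> u \<le> v"
proof (induction u arbitrary: v)
  case (Cons a u)
  then show ?case by (cases v) auto
qed auto

lemma strict_suffix_append_cases:
  assumes "strict_suffix v (l @ m)"
  obtains "v = m" | "strict_suffix v m" | s where "v = s @ m" "s \<noteq> []" "strict_suffix s l"
proof -
  from assms obtain r where r: "l @ m = r @ v" "r \<noteq> []"
    by (auto simp: strict_suffix_def suffix_def)
  from r(1) show ?thesis
    unfolding append_eq_append_conv2
  proof (elim exE conjE disjE)
    fix us assume us: "l = r @ us" "us @ m = v"
    show ?thesis
    proof (cases "us = []")
      case True
      then show ?thesis using us that(1) by simp
    next
      case False
      then show ?thesis using us r that(3)[of us] by (auto simp: strict_suffix_def suffix_def)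
    qed
  next
    fix us assume us: "l @ us = r" "m = us @ v"
    show ?thesis
    proof (cases "us = []")
      case True
      then show ?thesis using us that(1) by simp
    next
      case False
      then show ?thesis using us that(2) by (auto simp: strict_suffix_def suffix_def)
    qed
  qed
qed

lemma lyndon_less_suffix: "lyndon W \<Longrightarrow> V \<noteq> [] \<Longrightarrow> strict_suffix V W \<Longrightarrow> W < V"
  by (auto simp: lyndon_def)

lemma lyndon_nonempty: "lyndon W \<Longrightarrow> W \<noteq> []"
  by (auto simp: lyndon_def)

text \<open>
  If \<open>m = l @ x\<close>, cancelling \<open>l\<close> leaves \<open>m < x\<close>, which holds because \<open>x\<close> is a proper right factor
  of the Lyndon word \<open>m\<close>. If \<open>l\<close> is not a prefix of \<open>m\<close>, the two words differ before \<open>l\<close> ends.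
\<close>

lemma lyndon_append_less_right:
  assumes l: "lyndon l" and m: "lyndon m" and "l < m"
  shows "l @ m < m"
proof (cases "prefix l m")
  case False
  then show ?thesis using less_append_append[of l m m "[]"] \<open>l < m\<close> by simp
next
  case True
  then obtain x where x: "m = l @ x" by (auto simp: prefix_def)
  have "x \<noteq> []" using x \<open>l < m\<close> by auto
  moreover have "strict_suffix x m"
    using x lyndon_nonempty[OF l] by (auto simp: strict_suffix_def suffix_def)
  ultimately have "m < x" using lyndon_less_suffix[OF m] by blast
  then show ?thesis using x by (metis append_less_append_iff)
qed

text \<open>
  A right factor that reaches into \<open>l\<close> begins with a proper right factor \<open>s\<close> of \<open>l\<close>. The inequality
  \<open>l < s\<close> is decided before either word ends, since \<open>l\<close> is longer than \<open>s\<close>, and so it survives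
  appending. The other right factors are at least \<open>m\<close>.
\<close>

lemma lyndon_append:
  assumes l: "lyndon l" and m: "lyndon m" and "l < m"
  shows "lyndon (l @ m)"
  unfolding lyndon_def
proof (intro conjI allI impI)
  show "l @ m \<noteq> []" using lyndon_nonempty[OF l] by simp
next
  fix v assume v: "v \<noteq> [] \<and> strict_suffix v (l @ m)"
  have lm: "l @ m < m" by (rule lyndon_append_less_right[OF assms])
  from v have "strict_suffix v (l @ m)" by blast
  then show "l @ m < v"
  proof (cases rule: strict_suffix_append_cases)
    case 1
    then show ?thesis using lm by simp
  next
    case 2
    then show ?thesis using lm lyndon_less_suffix[OF m, of v] v by auto
  next
    case (3 s)
    then have "l < s" using lyndon_less_suffix[OF l] by blast
    moreover have "\<not> prefix l s"
      using 3 by (metis suffix_length_less leD prefix_length_le)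
    ultimately show ?thesis using 3 less_append_append by blast
  qed
qed

lemma min_right_factor_le:
  assumes "V \<noteq> []" "strict_suffix V W"
  shows "min_right_factor W \<le> V"
proof -
  have "finite {V. V \<noteq> [] \<and> strict_suffix V W}"
    by (rule finite_subset[of _ "set (suffixes W)"]) (auto simp: strict_suffix_def)
  then show ?thesis unfolding min_right_factor_def using assms by (intro Min_le) auto
qed

lemma lyndon_min_right_factor:
  assumes "2 \<le> length W"
  shows "lyndon (min_right_factor W)"
  unfolding lyndon_def
proof (intro conjI allI impI)
  show "min_right_factor W \<noteq> []" using min_right_factor[OF assms] by simp
next
  fix V assume V: "V \<noteq> [] \<and> strict_suffix V (min_right_factor W)"
  then have "strict_suffix V W"
    using min_right_factor(2)[OF assms] by (metis suffix_order.less_trans)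
  then have "min_right_factor W \<le> V" using V min_right_factor_le by blast
  moreover have "min_right_factor W \<noteq> V" using V by (auto simp: strict_suffix_def)
  ultimately show "min_right_factor W < V" by simp
qed

lemma left_cofactor_nonempty:
  assumes "2 \<le> length W"
  shows "left_cofactor W \<noteq> []"
  using left_cofactor_append[OF assms] min_right_factor(2)[OF assms]
  by (metis append_Nil suffix_order.less_irrefl)

text \<open>
  Let \<open>u\<close> be the cofactor of \<open>v\<close>. A proper right factor \<open>s\<close> of \<open>u\<close> satisfies \<open>uv < sv\<close>, so \<open>s < u\<close> is
  possible only for a prefix \<open>s\<close> of \<open>u\<close>. Cancelling it leaves a right factor \<open>tv\<close> of \<open>W\<close> that is
  smaller than \<open>v\<close>, against the minimality of \<open>v\<close>.
\<close>

lemma lyndon_left_cofactor: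
  assumes W: "lyndon W" and "2 \<le> length W"
  shows "lyndon (left_cofactor W)"
  unfolding lyndon_def
proof (intro conjI allI impI)
  show "left_cofactor W \<noteq> []" by (rule left_cofactor_nonempty[OF assms(2)])
next
  let ?u = "left_cofactor W" and ?v = "min_right_factor W"
  note uv = left_cofactor_append[OF assms(2)]
  fix s assume s: "s \<noteq> [] \<and> strict_suffix s ?u"
  then obtain r where r: "?u = r @ s" "r \<noteq> []" by (auto simp: strict_suffix_def suffix_def)
  have "strict_suffix (s @ ?v) W"
    using r uv by (auto simp: strict_suffix_def suffix_def) (metis append_assoc)
  then have less: "?u @ ?v < s @ ?v" using lyndon_less_suffix[OF W] s uv by simp
  show "?u < s"
  proof (rule ccontr)
    assume "\<not> ?u < s"
    moreover have "s \<noteq> ?u" using s by (auto simp: strict_suffix_def)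
    ultimately have su: "s < ?u" by simp
    show False
    proof (cases "prefix s ?u")
      case False
      then show ?thesis using less_append_append[OF su] less by (meson order.asym)
    next
      case True
      then obtain t where t: "?u = s @ t" by (auto simp: prefix_def)
      have "t @ ?v < ?v" using less t by simp
      moreover have "t @ ?v \<noteq> []" "strict_suffix (t @ ?v) W"
        using t uv s min_right_factor(1)[OF assms(2)]
        by (auto simp: strict_suffix_def suffix_def) (metis append_assoc)
      ultimately show False using min_right_factor_le by (metis linorder_not_less)
    qed
  qed
qed

lemma left_cofactor_less:
  assumes W: "lyndon W" and "2 \<le> length W"
  shows "left_cofactor W < W" "W < min_right_factor W"
proof -
  show "W < min_right_factor W"
    using lyndon_less_suffix[OF W] min_right_factor[OF assms(2)] by blast
  have "left_cofactor W \<le> W"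
    by (rule prefix_imp_le) (metis left_cofactor_append[OF assms(2)] prefixI)
  moreover have "left_cofactor W \<noteq> W"
    using left_cofactor_append[OF assms(2)] min_right_factor[OF assms(2)] by auto
  ultimately show "left_cofactor W < W" by simp
qed

text \<open>
  Under this condition \<open>[[l], [m]]\<close> is itself the Lyndon bracket of \<open>l @ m\<close>. Where it fails, the
  bracket has to be rewritten.
\<close>

lemma min_right_factor_append:
  assumes l: "lyndon l" and m: "lyndon m"
    and std: "length l = 1 \<or> m \<le> min_right_factor l"
  shows "min_right_factor (l @ m) = m"
proof (rule antisym)
  show "min_right_factor (l @ m) \<le> m"
    using lyndon_nonempty[OF l] lyndon_nonempty[OF m]
    by (intro min_right_factor_le) (auto simp: strict_suffix_def suffix_def)
next
  have "length (l @ m) \<ge> 2"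
    using lyndon_nonempty[OF l] lyndon_nonempty[OF m] by (cases l; cases m) auto
  note mrf = min_right_factor[OF this]
  let ?v = "min_right_factor (l @ m)"
  from mrf(2) show "m \<le> ?v"
  proof (cases rule: strict_suffix_append_cases)
    case 2
    then show ?thesis using lyndon_less_suffix[OF m _ 2] mrf by simp
  next
    case (3 s)
    have "length l \<noteq> 1"
    proof
      assume "length l = 1"
      moreover have "length s < length l" using 3(3) by (rule suffix_length_less)
      ultimately show False using 3 by simp
    qed
    then have "m \<le> min_right_factor l" using std by simp
    also have "\<dots> \<le> s" using 3 min_right_factor_le by blast
    also have "s \<le> s @ m" by (rule prefix_imp_le) simp
    finally show ?thesis using 3 by simp
  qed auto
qed

lemma left_cofactor_append_eq:
  assumes "min_right_factor (l @ m) = m"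
  shows "left_cofactor (l @ m) = l"
  using assms by (simp add: left_cofactor_def)

section \<open>Linear maps and the Lie bracket\<close>

lemma linearQI:
  fixes f :: "'a::rat_vector \<Rightarrow> 'b::rat_vector"
  assumes "\<And>x y. f (x + y) = f x + f y" "\<And>c x. f (c *\<^sub>Q x) = c *\<^sub>Q f x"
  shows "linearQ f"
  by (rule Vector_Spaces.linear_iff[THEN iffD2]) (auto simp: assms rv.vector_space_axioms)

lemma span_linear_image:
  assumes "linearQ f" "\<And>a. a \<in> A \<Longrightarrow> f a \<in> rv.span C" "x \<in> rv.span A"
  shows "f x \<in> rv.span C"
  using assms(3)
proof (induction rule: rv.span_induct_alt)
  case base
  then show ?case by (simp add: rvp.linear_0[OF assms(1)] rv.span_zero)
next
  case (step c x y)
  then show ?case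
    by (simp add: rvp.linear_add[OF assms(1)] rvp.linear_scale[OF assms(1)] assms(2)
      rv.span_add rv.span_scale)
qed

lemma span_bilinear_image:
  assumes "\<And>y. linearQ (\<lambda>x. op x y)" "\<And>x. linearQ (op x)"
    "\<And>a b. a \<in> A \<Longrightarrow> b \<in> B \<Longrightarrow> op a b \<in> rv.span C"
    and x: "x \<in> rv.span A" and y: "y \<in> rv.span B"
  shows "op x y \<in> rv.span C"
proof (rule span_linear_image[OF assms(1) _ x])
  fix a assume "a \<in> A"
  then show "op a y \<in> rv.span C"
    by (intro span_linear_image[OF assms(2) _ y] assms(3))
qed

lemma lie_bracket_add_left: "lie_bracket (f + f') g = lie_bracket f g + lie_bracket f' g"
  by transfer (simp add: bilin_ext_add_left lie_equiv_def lie_ideal_zero)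

lemma lie_bracket_add_right: "lie_bracket f (g + g') = lie_bracket f g + lie_bracket f g'"
  by transfer (simp add: bilin_ext_add_right lie_equiv_def lie_ideal_zero)

lemma lie_bracket_scale_left: "lie_bracket (c *\<^sub>Q f) g = c *\<^sub>Q lie_bracket f g"
  by transfer (simp add: bilin_ext_scale_left lie_equiv_def lie_ideal_zero)

lemma lie_bracket_scale_right: "lie_bracket f (c *\<^sub>Q g) = c *\<^sub>Q lie_bracket f g"
  by transfer (simp add: bilin_ext_scale_right lie_equiv_def lie_ideal_zero)

lemma lie_of_tree_Node: "lie_of_tree (Node s t) = lie_bracket (lie_of_tree s) (lie_of_tree t)"
  by transfer (simp add: lie_equiv_def lie_ideal_zero)

lemma linear_lie_bracket_left: "linearQ (\<lambda>f. lie_bracket f g)"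
  by (intro linearQI lie_bracket_add_left lie_bracket_scale_left)

lemma linear_lie_bracket_right: "linearQ (lie_bracket f)"
  by (intro linearQI lie_bracket_add_right lie_bracket_scale_right)

lemmas lie_bracket_uminus_left [simp] = rvp.linear_neg[OF linear_lie_bracket_left]
lemmas lie_bracket_uminus_right [simp] = rvp.linear_neg[OF linear_lie_bracket_right]
lemmas lie_bracket_diff_left = rvp.linear_diff[OF linear_lie_bracket_left]
lemmas lie_bracket_diff_right = rvp.linear_diff[OF linear_lie_bracket_right]
lemmas lie_bracket_zero_left [simp] = rvp.linear_0[OF linear_lie_bracket_left]
lemmas lie_bracket_zero_right [simp] = rvp.linear_0[OF linear_lie_bracket_right]

lemma lie_induct [case_names tree add scale]:
  assumes tree: "\<And>t. P (lie_of_tree t)"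
    and add: "\<And>f g. P f \<Longrightarrow> P g \<Longrightarrow> P (f + g)"
    and scale: "\<And>c f. P f \<Longrightarrow> P (c *\<^sub>Q f)"
  shows "P f"
proof -
  have "P (abs_lie p)" for p
  proof (induction p rule: gen_induct)
    case (gen t)
    then show ?case using tree[of t] by (simp add: lie_of_tree.abs_eq)
  next
    case (add p q)
    then show ?case using assms(2) by (metis plus_lie.abs_eq)
  next
    case (scale c p)
    then show ?case using assms(3) by (metis scaleQ_lie.abs_eq)
  qed
  then show ?thesis by (metis Quotient3_abs_rep Quotient3_lie)
qed

lemma lie_bracket_antisym_tree:
  "lie_bracket (lie_of_tree s) (lie_of_tree t) + lie_bracket (lie_of_tree t) (lie_of_tree s) = 0"
  by transfer (simp add: lie_equiv_def lie_ideal.antisymmetry)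

lemma lie_bracket_jacobi_tree:
  "lie_bracket (lie_of_tree r) (lie_bracket (lie_of_tree s) (lie_of_tree t))
    + lie_bracket (lie_of_tree s) (lie_bracket (lie_of_tree t) (lie_of_tree r))
    + lie_bracket (lie_of_tree t) (lie_bracket (lie_of_tree r) (lie_of_tree s)) = 0"
  by transfer (simp add: lie_equiv_def lie_ideal.jacobi)

lemma lie_bracket_antisym_sum: "lie_bracket f g + lie_bracket g f = 0"
proof (induction f rule: lie_induct)
  case (tree s)
  show ?case
  proof (induction g rule: lie_induct)
    case (tree t)
    show ?case by (rule lie_bracket_antisym_tree)
  next
    case (add f g)
    then show ?case by (simp add: lie_bracket_add_left lie_bracket_add_right algebra_simps)
  next
    case (scale c f)
    then show ?case
      by (simp add: lie_bracket_scale_left lie_bracket_scale_right flip: scaleQ_add_right)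
  qed
next
  case (add f f')
  then show ?case
    by (simp add: lie_bracket_add_left lie_bracket_add_right add_eq_0_iff)
next
  case (scale c f)
  then show ?case
    by (simp add: lie_bracket_scale_left lie_bracket_scale_right flip: scaleQ_add_right)
qed

lemma lie_bracket_antisym: "lie_bracket f g = - lie_bracket g f"
  using lie_bracket_antisym_sum by (simp add: eq_neg_iff_add_eq_0)

lemma rat_vector_double_eq_0:
  fixes x :: "'a::rat_vector"
  assumes "x + x = 0"
  shows "x = 0"
proof -
  have "(2::rat) *\<^sub>Q x = (1 + 1) *\<^sub>Q x" by simp
  also have "\<dots> = 0" using assms by (simp only: scaleQ_add_left scaleQ_one)
  finally show ?thesis by (simp add: rv.scale_eq_0_iff)
qed

lemma lie_bracket_self [simp]: "lie_bracket f f = 0"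
  using rat_vector_double_eq_0[OF lie_bracket_antisym_sum] .

lemma lie_bracket_jacobi:
  "lie_bracket f (lie_bracket g h) + lie_bracket g (lie_bracket h f)
    + lie_bracket h (lie_bracket f g) = 0" (is "?J f g h = 0")
proof -
  note lins = lie_bracket_add_left lie_bracket_add_right lie_bracket_scale_left
    lie_bracket_scale_right
  have add: "?J (f + f') g h = ?J f g h + ?J f' g h" for f f' g h
    by (simp add: lins algebra_simps)
  have scale: "?J (c *\<^sub>Q f) g h = c *\<^sub>Q ?J f g h" for c f g h
    by (simp add: lins scaleQ_add_right)
  \<comment> \<open>Linearity is needed in each slot; a rotation moves the slot to the front.\<close>
  have rot: "?J f g h = ?J g h f" for f g h
    by (simp add: algebra_simps)
  have 1: "?J (lie_of_tree r) (lie_of_tree s) h = 0" for r s h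
  proof (induction h rule: lie_induct)
    case (tree t)
    show ?case by (rule lie_bracket_jacobi_tree)
  qed (simp_all only: rot[of "lie_of_tree r"] rot[of "lie_of_tree s"] add scale rv.scale_zero_right add_0)
  have 2: "?J (lie_of_tree r) g h = 0" for r g h
  proof (induction g rule: lie_induct)
    case (tree t)
    show ?case by (rule 1)
  qed (simp_all only: rot[of "lie_of_tree r"] add scale rv.scale_zero_right add_0)
  show ?thesis
    by (induction f rule: lie_induct) (simp_all only: 2 add scale rv.scale_zero_right add_0)
qed

lemma lie_bracket_leibniz_left:
  "lie_bracket (lie_bracket f g) h
    = lie_bracket (lie_bracket f h) g + lie_bracket f (lie_bracket g h)"
proof -
  have "lie_bracket (lie_bracket f h) g = lie_bracket g (lie_bracket h f)"
    using lie_bracket_antisym[of "lie_bracket f h" g] lie_bracket_antisym[of f h] by simp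
  moreover have "lie_bracket (lie_bracket f g) h = - lie_bracket h (lie_bracket f g)"
    by (rule lie_bracket_antisym)
  ultimately show ?thesis using lie_bracket_jacobi[of f g h]
    by (simp add: add_eq_0_iff add.commute)
qed

section \<open>The Lyndon brackets span the free Lie algebra\<close>

lemma lyndon_bracket_std:
  assumes "2 \<le> length W"
  shows "lyndon_bracket W
    = lie_bracket (lyndon_bracket (left_cofactor W)) (lyndon_bracket (min_right_factor W))"
  using assms by (subst lyndon_bracket.simps) auto

lemma lyndon_bracket_append:
  assumes "lyndon l" "lyndon m" "length l = 1 \<or> m \<le> min_right_factor l"
  shows "lyndon_bracket (l @ m) = lie_bracket (lyndon_bracket l) (lyndon_bracket m)"
proof -
  have "min_right_factor (l @ m) = m" by (rule min_right_factor_append[OF assms])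
  moreover from this have "left_cofactor (l @ m) = l" by (rule left_cofactor_append_eq)
  moreover have "2 \<le> length (l @ m)"
    using lyndon_nonempty[OF assms(1)] lyndon_nonempty[OF assms(2)] by (cases l; cases m) auto
  ultimately show ?thesis
    using lyndon_bracket_std[of "l @ m"] by simp
qed

text \<open>
  If \<open>[[l], [m]]\<close> is not a Lyndon bracket, then \<open>l\<close> has the standard factorization \<open>l' l''\<close> with
  \<open>l'' < m\<close>, and \<open>[[l', l''], m] = [[l', m], l''] + [l', [l'', m]]\<close>. The inner brackets have smaller
  total length, so they are combinations of \<open>[n]\<close> with \<open>n < m\<close>. This leaves outer brackets of the
  original total length, but of two words that are both below \<open>m\<close>. The recursion on the total
  length and then on the larger of the two words ends because there are only finitely many words
  of bounded length. The bound \<open>n < m\<close> in the conclusion is there for the sake of this induction.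
\<close>

lemma lyndon_bracket_rewrite:
  assumes "lyndon l" "lyndon m" "l < m"
  shows "lie_bracket (lyndon_bracket l) (lyndon_bracket m)
    \<in> rv.span {lyndon_bracket n | n. lyndon n \<and> n < m \<and> length n = length l + length m}"
  using assms
proof (induction "length l + length m" arbitrary: l m rule: less_induct)
  case outer: less
  let ?P = "\<lambda>N m. {lyndon_bracket n | n. lyndon n \<and> n < m \<and> length n = N}"
  define N where "N = length l + length m"
  have "lie_bracket (lyndon_bracket l) (lyndon_bracket m) \<in> rv.span (?P N m)"
    if "lyndon l" "lyndon m" "l < m" "length l + length m = N" for l m
    using that
  proof (induction "card {w::word. length w \<le> N \<and> w < m}" arbitrary: l m rule: less_induct)
    case less
    note l = \<open>lyndon l\<close> and m = \<open>lyndon m\<close>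
    show ?case
    proof (cases "length l = 1 \<or> m \<le> min_right_factor l")
      case True
      then have "lie_bracket (lyndon_bracket l) (lyndon_bracket m) = lyndon_bracket (l @ m)"
        using lyndon_bracket_append[OF l m] by simp
      moreover have "lyndon_bracket (l @ m) \<in> ?P N m"
        using lyndon_append[OF l m] lyndon_append_less_right[OF l m] less.prems by auto
      ultimately show ?thesis by (simp add: rv.span_base)
    next
      case False
      have len: "2 \<le> length l"
        using False lyndon_nonempty[OF l] by (cases l) (auto simp: Suc_le_eq)
      define l' l'' where "l' = left_cofactor l" and "l'' = min_right_factor l"
      have l': "lyndon l'" "l' < l" "0 < length l'"
        and l'': "lyndon l''" "l'' < m" "0 < length l''"
        and ll: "length l = length l' + length l''"
        using False lyndon_left_cofactor[OF l len] lyndon_min_right_factor[OF len]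
          left_cofactor_less[OF l len] left_cofactor_nonempty[OF len] min_right_factor(1)[OF len]
          left_cofactor_append[OF len, THEN arg_cong, of length]
        by (auto simp: l'_def l''_def)
      have below: "lie_bracket (lyndon_bracket a) (lyndon_bracket b) \<in> rv.span (?P N m)"
        if "lyndon a" "lyndon b" "a < m" "b < m" "length a + length b = N" for a b
      proof -
        have *: "lie_bracket (lyndon_bracket a) (lyndon_bracket b) \<in> rv.span (?P N m)"
          if ab: "lyndon a" "lyndon b" "a < b" "b < m" "length a + length b = N" for a b
        proof -
          \<comment> \<open>The position of the larger word among all words of bounded length decreases.\<close>
          have "finite {w::word. length w \<le> N}"
            using finite_lists_length_le[of "UNIV :: bool set" N] by simp
          then have "card {w. length w \<le> N \<and> w < b} < card {w. length w \<le> N \<and> w < m}"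
            using ab by (intro psubset_card_mono) (auto dest: order.strict_trans)
          then have "lie_bracket (lyndon_bracket a) (lyndon_bracket b) \<in> rv.span (?P N b)"
            using ab by (intro less.hyps) auto
          moreover have "?P N b \<subseteq> ?P N m" using ab by (auto dest: order.strict_trans)
          ultimately show ?thesis using rv.span_mono by blast
        qed
        consider "a < b" | "a = b" | "b < a" by (rule linorder_cases)
        then show ?thesis
        proof cases
          case 3
          then show ?thesis
            using *[of b a] that lie_bracket_antisym[of "lyndon_bracket a"] rv.span_neg
            by (simp add: add.commute)
        qed (use * that rv.span_zero in auto)
      qed
      have "lie_bracket (lyndon_bracket l') (lyndon_bracket m)
          \<in> rv.span (?P (length l' + length m) m)"
        using l' l'' ll less.prems N_def
        by (intro outer.hyps) (auto dest: order.strict_trans simp del: length_greater_0_conv)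
      then have 1: "lie_bracket (lie_bracket (lyndon_bracket l') (lyndon_bracket m))
          (lyndon_bracket l'') \<in> rv.span (?P N m)"
      proof (rule span_linear_image[OF linear_lie_bracket_left, rotated])
        fix a assume "a \<in> ?P (length l' + length m) m"
        then obtain n where "a = lyndon_bracket n" "lyndon n" "n < m"
          "length n = length l' + length m" by blast
        then show "lie_bracket a (lyndon_bracket l'') \<in> rv.span (?P N m)"
          using below[of n l''] l'' ll less.prems by simp
      qed
      have "lie_bracket (lyndon_bracket l'') (lyndon_bracket m)
          \<in> rv.span (?P (length l'' + length m) m)"
        using l' l'' ll less.prems N_def
        by (intro outer.hyps) (auto simp del: length_greater_0_conv)
      then have 2: "lie_bracket (lyndon_bracket l')
          (lie_bracket (lyndon_bracket l'') (lyndon_bracket m)) \<in> rv.span (?P N m)"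
      proof (rule span_linear_image[OF linear_lie_bracket_right, rotated])
        fix a assume "a \<in> ?P (length l'' + length m) m"
        then obtain n where n: "a = lyndon_bracket n" "lyndon n" "n < m"
          "length n = length l'' + length m" by blast
        have "l' < m" using l' less.prems by (metis order.strict_trans)
        then show "lie_bracket (lyndon_bracket l') a \<in> rv.span (?P N m)"
          using below[of l' n] n l' ll less.prems by simp
      qed
      have "lyndon_bracket l = lie_bracket (lyndon_bracket l') (lyndon_bracket l'')"
        using lyndon_bracket_std[OF len] by (simp add: l'_def l''_def)
      then show ?thesis
        using rv.span_add[OF 1 2] by (simp add: lie_bracket_leibniz_left[of _ "lyndon_bracket l''"])
    qed
  qed
  from this[OF outer.prems] show ?case by (simp add: N_def)
qed

abbreviation lyndon_brackets_of_length :: "nat \<Rightarrow> lie set" where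
  "lyndon_brackets_of_length n \<equiv> {lyndon_bracket W | W. lyndon W \<and> length W = n}"

lemma lie_bracket_lyndon_span:
  assumes U: "lyndon U" and V: "lyndon V"
  shows "lie_bracket (lyndon_bracket U) (lyndon_bracket V)
    \<in> rv.span (lyndon_brackets_of_length (length U + length V))"
proof -
  have *: "lie_bracket (lyndon_bracket U) (lyndon_bracket V)
    \<in> rv.span (lyndon_brackets_of_length (length U + length V))"
    if "lyndon U" "lyndon V" "U < V" for U V
    using lyndon_bracket_rewrite[OF that]
    by (rule set_mp[OF rv.span_mono, rotated]) auto
  show ?thesis
    using *[OF assms] *[OF V U] lie_bracket_antisym[of "lyndon_bracket U"] rv.span_zero rv.span_neg
    by (cases rule: linorder_cases[of U V]) (auto simp: add.commute)
qed

lemma lie_of_tree_in_lyndon_span: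
  "lie_of_tree t \<in> rv.span (lyndon_brackets_of_length (leaves t))"
proof (induction t)
  case (Leaf b)
  have "lyndon [b]"
    by (auto simp: lyndon_def dest: suffix_length_less)
  moreover have "lyndon_bracket [b] = lie_of_tree (Leaf b)"
    by (subst lyndon_bracket.simps) simp
  ultimately show ?case by (intro rv.span_base) (auto intro!: exI[of _ "[b]"])
next
  case (Node s t)
  show ?case
    unfolding lie_of_tree_Node leaves.simps
  proof (rule span_bilinear_image[OF linear_lie_bracket_left linear_lie_bracket_right _ Node])
    fix a b
    assume "a \<in> lyndon_brackets_of_length (leaves s)" "b \<in> lyndon_brackets_of_length (leaves t)"
    then obtain U V where "a = lyndon_bracket U" "lyndon U" "length U = leaves s"
      "b = lyndon_bracket V" "lyndon V" "length V = leaves t" by auto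
    then show "lie_bracket a b \<in> rv.span (lyndon_brackets_of_length (leaves s + leaves t))"
      using lie_bracket_lyndon_span[of U V] by simp
  qed
qed

lemma lie_grade_subset_lyndon_span: "lie_grade n \<subseteq> rv.span (lyndon_brackets_of_length n)"
  unfolding lie_grade_def
  by (rule rv.span_minimal) (use lie_of_tree_in_lyndon_span in auto)

lemma lyndon_brackets_span: "rv.span {lyndon_bracket W | W. lyndon W} = UNIV"
proof -
  have "f \<in> rv.span {lyndon_bracket W | W. lyndon W}" for f
  proof (induction f rule: lie_induct)
    case (tree t)
    have "lyndon_brackets_of_length (leaves t) \<subseteq> {lyndon_bracket W | W. lyndon W}" by auto
    then show ?case using lie_of_tree_in_lyndon_span rv.span_mono by blast
  qed (auto intro: rv.span_add rv.span_scale)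
  then show ?thesis by auto
qed

section \<open>The Lyndon brackets are linearly independent\<close>

lemma bilin_ext_append_assoc:
  "bilin_ext (@) (bilin_ext (@) p q) r = bilin_ext (@) p (bilin_ext (@) q r)"
proof -
  note lins = bilin_ext_add_left bilin_ext_add_right bilin_ext_scale_left bilin_ext_scale_right
  have 1: "bilin_ext (@) (bilin_ext (@) (gen xs) (gen ys)) r
      = bilin_ext (@) (gen xs) (bilin_ext (@) (gen ys) r)" for xs ys :: "'a list"
    by (induction r rule: gen_induct) (simp_all add: lins)
  have 2: "bilin_ext (@) (bilin_ext (@) (gen xs) q) r
      = bilin_ext (@) (gen xs) (bilin_ext (@) q r)" for xs :: "'a list"
    by (induction q rule: gen_induct) (simp_all only: lins 1)
  show ?thesis
    by (induction p rule: gen_induct) (simp_all only: lins 2)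
qed

lemma linear_bilin_ext: 
  "linearQ (\<lambda>p. bilin_ext op p q)" "linearQ (bilin_ext op p)"
  by (auto intro!: linearQI 
    simp: bilin_ext_add_left bilin_ext_add_right bilin_ext_scale_left bilin_ext_scale_right)

text \<open>
  The free Lie algebra is mapped to the free associative algebra, with basis the words, where the
  bracket becomes the commutator and where coefficients can be read off.
\<close>

fun assoc_of_tree :: "tree \<Rightarrow> (word \<Rightarrow>\<^sub>0 rat)" where
  "assoc_of_tree (Leaf b) = gen [b]"
| "assoc_of_tree (Node s t) = bilin_ext (@) (assoc_of_tree s) (assoc_of_tree t)
    - bilin_ext (@) (assoc_of_tree t) (assoc_of_tree s)"

lemma lin_ext_assoc_of_tree_Node:
  "lin_ext assoc_of_tree (bilin_ext Node p q)
    = bilin_ext (@) (lin_ext assoc_of_tree p) (lin_ext assoc_of_tree q)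
    - bilin_ext (@) (lin_ext assoc_of_tree q) (lin_ext assoc_of_tree p)"
proof -
  note lins = lin_ext_add lin_ext_scale bilin_ext_add_left bilin_ext_add_right
    bilin_ext_scale_left bilin_ext_scale_right rv.scale_right_diff_distrib
  show ?thesis
  proof (induction p rule: gen_induct)
    case (gen s)
    show ?case
      by (induction q rule: gen_induct) (simp, simp add: lins, simp only: lins)
  qed (simp add: lins, simp only: lins)
qed

lemma lin_ext_assoc_of_tree_ideal: "p \<in> lie_ideal \<Longrightarrow> lin_ext assoc_of_tree p = 0"
proof (induction rule: lie_ideal.induct)
  case (jacobi r s t)
  then show ?case
    by (simp add: lin_ext_add rvp.linear_diff[OF linear_bilin_ext(1)]
      rvp.linear_diff[OF linear_bilin_ext(2)] bilin_ext_append_assoc)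
qed (simp_all add: lin_ext_add lin_ext_scale lin_ext_assoc_of_tree_Node
      rvp.linear_0[OF linear_bilin_ext(1)] rvp.linear_0[OF linear_bilin_ext(2)])

lift_definition assoc_of_lie :: "lie \<Rightarrow> (word \<Rightarrow>\<^sub>0 rat)" is "lin_ext assoc_of_tree"
  unfolding lie_equiv_def
  using lin_ext_assoc_of_tree_ideal lin_ext_diff by (metis eq_iff_diff_eq_0)

lemma assoc_of_lie_bracket:
  "assoc_of_lie (lie_bracket f g)
    = bilin_ext (@) (assoc_of_lie f) (assoc_of_lie g) - bilin_ext (@) (assoc_of_lie g) (assoc_of_lie f)"
  by transfer (rule lin_ext_assoc_of_tree_Node)

lemma assoc_of_lie_of_tree: "assoc_of_lie (lie_of_tree t) = assoc_of_tree t"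
  by transfer simp

lemma linear_assoc_of_lie: "linearQ assoc_of_lie"
  by (rule linearQI; transfer) (simp_all add: lin_ext_add lin_ext_scale)

abbreviation gens_above :: "word \<Rightarrow> (word \<Rightarrow>\<^sub>0 rat) set" where
  "gens_above W \<equiv> {gen V | V. length V = length W \<and> W < V}"

text \<open>
  Let \<open>W = UV\<close> be the standard factorization. In the commutator of \<open>U + \<dots>\<close> and \<open>V + \<dots>\<close> the products
  in the order \<open>UV\<close> have \<open>W\<close> as their smallest word. Those in the opposite order begin with a word
  \<open>V' \<ge> V\<close> and are larger than \<open>W\<close> because \<open>V > W\<close>.
\<close>

lemma assoc_of_lyndon_bracket:
  assumes "lyndon W"
  shows "assoc_of_lie (lyndon_bracket W) - gen W \<in> rv.span (gens_above W)"
  using assms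
proof (induction "length W" arbitrary: W rule: less_induct)
  case less
  show ?case
  proof (cases "length W = 1")
    case True
    then obtain b where "W = [b]" by (auto simp: length_Suc_conv)
    then show ?thesis
      by (simp add: lyndon_bracket.simps[of "[b]"] assoc_of_lie_of_tree rv.span_zero)
  next
    case False
    have len: "2 \<le> length W"
      using False lyndon_nonempty[OF less.prems] by (cases W) (auto simp: Suc_le_eq)
    define U V where "U = left_cofactor W" and "V = min_right_factor W"
    have UV: "U @ V = W" using left_cofactor_append[OF len] by (simp add: U_def V_def)
    have "U \<noteq> []" "V \<noteq> []"
      using left_cofactor_nonempty[OF len] min_right_factor(1)[OF len] by (auto simp: U_def V_def)
    then have lens: "length U < length W" "length V < length W" "length W = length U + length V"
      using UV by auto
    have lyn: "lyndon U" "lyndon V"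
      using lyndon_left_cofactor[OF less.prems len] lyndon_min_right_factor[OF len]
      by (auto simp: U_def V_def)
    have "W < V" using left_cofactor_less[OF less.prems len] by (simp add: V_def)
    define p q where "p = assoc_of_lie (lyndon_bracket U) - gen U"
      and "q = assoc_of_lie (lyndon_bracket V) - gen V"
    have p: "p \<in> rv.span (gens_above U)" and q: "q \<in> rv.span (gens_above V)"
      using less.hyps lyn lens by (auto simp: p_def q_def)
    let ?geU = "insert (gen U) (gens_above U)" and ?geV = "insert (gen V) (gens_above V)"
    have pU: "gen U + p \<in> rv.span ?geU" and qV: "gen V + q \<in> rv.span ?geV"
      using set_mp[OF rv.span_mono[OF subset_insertI] p] set_mp[OF rv.span_mono[OF subset_insertI] q]
      by (simp_all add: rv.span_add rv.span_base)
    note mult = span_bilinear_image[OF linear_bilin_ext]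
    have 1: "bilin_ext (@) (gen U) q \<in> rv.span (gens_above W)"
      by (rule span_linear_image[OF linear_bilin_ext(2) _ q])
        (auto intro!: rv.span_base simp flip: UV)
    have 2: "bilin_ext (@) p (gen V + q) \<in> rv.span (gens_above W)"
    proof (rule mult[OF _ p qV], rule rv.span_base)
      fix a b assume "a \<in> gens_above U" "b \<in> ?geV"
      then obtain U' V' where *: "a = gen U'" "length U' = length U" "U < U'"
        "b = gen V'" "length V' = length V" by auto
      then have "\<not> prefix U U'" by (auto simp: prefix_def)
      then show "bilin_ext (@) a b \<in> gens_above W"
        using * less_append_append[of U U' V V'] by (auto simp flip: UV)
    qed
    have 3: "bilin_ext (@) (gen V + q) (gen U + p) \<in> rv.span (gens_above W)"
    proof (rule mult[OF _ qV pU], rule rv.span_base)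
      fix b a assume "b \<in> ?geV" "a \<in> ?geU"
      then obtain U' V' where *: "a = gen U'" "length U' = length U" 
        "b = gen V'" "length V' = length V" "V \<le> V'" by auto
      have "W < V" by fact
      also have "V \<le> V'" by fact
      also have "V' \<le> V' @ U'" by (rule prefix_imp_le) simp
      finally show "bilin_ext (@) b a \<in> gens_above W"
        using * by (auto simp flip: UV)
    qed
    have "assoc_of_lie (lyndon_bracket W)
        = bilin_ext (@) (gen U + p) (gen V + q) - bilin_ext (@) (gen V + q) (gen U + p)"
      using lyndon_bracket_std[OF len] by (simp add: assoc_of_lie_bracket p_def q_def U_def V_def)
    also have "bilin_ext (@) (gen U + p) (gen V + q)
        = gen W + (bilin_ext (@) (gen U) q + bilin_ext (@) p (gen V + q))"
      by (simp add: bilin_ext_add_left bilin_ext_add_right UV algebra_simps)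
    finally show ?thesis
      using rv.span_diff[OF rv.span_add[OF 1 2] 3] by simp
  qed
qed

lemma lookup_span_gen:
  assumes "p \<in> rv.span {gen V | V. P V}" "\<not> P W"
  shows "Poly_Mapping.lookup p W = 0"
  using assms(1)
  by (induction rule: rv.span_induct_alt)
    (use assms(2) in \<open>auto simp: lookup_add scaleQ_rat_def lookup_single when_def split: if_splits\<close>)

lemma lookup_assoc_of_lyndon_bracket:
  assumes "lyndon V" "\<not> V < W"
  shows "Poly_Mapping.lookup (assoc_of_lie (lyndon_bracket V)) W = of_bool (V = W)"
proof -
  have "Poly_Mapping.lookup (assoc_of_lie (lyndon_bracket V) - gen V) W = 0"
    using assoc_of_lyndon_bracket[OF assms(1)]
    by (rule lookup_span_gen) (use assms(2) in auto)
  then show ?thesis by (auto simp: lookup_minus lookup_single when_def)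
qed

lemma inj_on_lyndon_bracket: "inj_on lyndon_bracket (Collect lyndon)"
proof (rule linorder_inj_onI)
  fix U V assume "U < V" "U \<in> Collect lyndon" "V \<in> Collect lyndon"
  then have "Poly_Mapping.lookup (assoc_of_lie (lyndon_bracket U)) U = 1"
    "Poly_Mapping.lookup (assoc_of_lie (lyndon_bracket V)) U = 0"
    by (simp_all add: lookup_assoc_of_lyndon_bracket)
  then show "lyndon_bracket U \<noteq> lyndon_bracket V" by (metis zero_neq_one)
qed auto

lemma lyndon_brackets_independent: "rv.independent {lyndon_bracket W | W. lyndon W}"
  unfolding rv.independent_explicit_finite_subsets
proof (intro allI impI ballI)
  fix S u v
  assume S: "S \<subseteq> {lyndon_bracket W | W. lyndon W}" "finite S"
    and sum: "(\<Sum>v\<in>S. u v *\<^sub>Q v) = 0" and v: "v \<in> S"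
  show "u v = 0"
  proof (rule ccontr)
    assume "u v \<noteq> 0"
    \<comment> \<open>The smallest word that occurs in a relation has a coefficient that nothing can cancel.\<close>
    define F where "F = {W. lyndon W \<and> lyndon_bracket W \<in> S \<and> u (lyndon_bracket W) \<noteq> 0}"
    have "finite F"
    proof (rule finite_imageD)
      show "finite (lyndon_bracket ` F)"
        by (rule finite_subset[OF _ S(2)]) (auto simp: F_def)
      show "inj_on lyndon_bracket F"
        by (rule inj_on_subset[OF inj_on_lyndon_bracket]) (auto simp: F_def)
    qed
    moreover have "F \<noteq> {}" using v S \<open>u v \<noteq> 0\<close> by (auto simp: F_def)
    ultimately have "Min F \<in> F" and min: "\<And>W. W \<in> F \<Longrightarrow> Min F \<le> W" by auto
    then have M: "lyndon (Min F)" "lyndon_bracket (Min F) \<in> S" "u (lyndon_bracket (Min F)) \<noteq> 0"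
      by (auto simp: F_def)
    have coeff: "u v * Poly_Mapping.lookup (assoc_of_lie v) (Min F)
        = (if v = lyndon_bracket (Min F) then u v else 0)" if vS: "v \<in> S" for v
    proof -
      obtain W where W: "v = lyndon_bracket W" "lyndon W" using S vS by auto
      show ?thesis
      proof (cases "u v = 0")
        case False
        then have "W \<in> F" using W vS by (auto simp: F_def)
        then have "Poly_Mapping.lookup (assoc_of_lie v) (Min F) = of_bool (W = Min F)"
          using W min[of W] lookup_assoc_of_lyndon_bracket[of W "Min F"] by auto
        moreover have "W = Min F \<longleftrightarrow> v = lyndon_bracket (Min F)"
          using W M inj_on_lyndon_bracket by (auto simp: inj_on_def)
        ultimately show ?thesis by simp
      qed auto
    qed
    have "0 = Poly_Mapping.lookup (assoc_of_lie (\<Sum>v\<in>S. u v *\<^sub>Q v)) (Min F)"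
      using sum by (simp add: rvp.linear_0[OF linear_assoc_of_lie])
    also have "\<dots> = (\<Sum>v\<in>S. u v * Poly_Mapping.lookup (assoc_of_lie v) (Min F))"
      by (simp add: rvp.linear_sum[OF linear_assoc_of_lie] rvp.linear_scale[OF linear_assoc_of_lie]
        lookup_sum scaleQ_rat_def)
    also have "\<dots> = u (lyndon_bracket (Min F))"
      using M(2) S(2) by (simp add: coeff)
    finally show False using M by simp
  qed
qed

section \<open>Derivations of the free Lie algebra\<close>

fun der_of_tree :: "lie \<Rightarrow> tree \<Rightarrow> lie" where
  "der_of_tree f (Leaf b) = (if b then lie_bracket X1 f else 0)"
| "der_of_tree f (Node s t) =
    lie_bracket (der_of_tree f s) (lie_of_tree t) + lie_bracket (lie_of_tree s) (der_of_tree f t)"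

lemma abs_lie_gen: "abs_lie (gen t) = lie_of_tree t"
  by (simp add: lie_of_tree.abs_eq)

lemma abs_lie_add: "abs_lie (p + q) = abs_lie p + abs_lie q"
  by (simp add: plus_lie.abs_eq)

lemma abs_lie_scale: "abs_lie (c *\<^sub>Q p) = c *\<^sub>Q abs_lie p"
  by (simp add: scaleQ_lie.abs_eq)

lemma abs_lie_eq_0: "p \<in> lie_ideal \<Longrightarrow> abs_lie p = 0"
  by (simp add: zero_lie_def lie.abs_eq_iff lie_equiv_def)

lemma lin_ext_der_of_tree_Node:
  "lin_ext (der_of_tree f) (bilin_ext Node p q)
    = lie_bracket (lin_ext (der_of_tree f) p) (abs_lie q)
    + lie_bracket (abs_lie p) (lin_ext (der_of_tree f) q)"
proof -
  note lins = lin_ext_add lin_ext_scale bilin_ext_add_left bilin_ext_add_right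
    bilin_ext_scale_left bilin_ext_scale_right abs_lie_gen abs_lie_add abs_lie_scale
    lie_bracket_add_left lie_bracket_add_right lie_bracket_scale_left lie_bracket_scale_right
    scaleQ_add_right
  show ?thesis
  proof (induction p rule: gen_induct)
    case (gen s)
    show ?case
    proof (induction q rule: gen_induct)
      case (gen t)
      show ?case by (simp add: abs_lie_gen)
    next
      case (add p q)
      then show ?case by (simp add: lins)
    next
      case (scale c p)
      then show ?case by (simp only: lins)
    qed
  next
    case (add p q)
    then show ?case by (simp add: lins)
  next
    case (scale c p)
    then show ?case by (simp only: lins)
  qed
qed

text \<open>
  Differentiating a Jacobi relation gives three Jacobi relations, in each of which one of the
  entries is differentiated.
\<close>

lemma lin_ext_der_of_tree_ideal: "p \<in> lie_ideal \<Longrightarrow> lin_ext (der_of_tree f) p = 0"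
proof (induction rule: lie_ideal.induct)
  case (antisymmetry s t)
  then show ?case
    using lie_bracket_antisym_sum[of "der_of_tree f s" "lie_of_tree t"]
      lie_bracket_antisym_sum[of "lie_of_tree s" "der_of_tree f t"]
    by (simp add: lin_ext_add algebra_simps) (metis add.assoc add.commute add_0)
next
  case (jacobi r s t)
  let ?D = "der_of_tree f" and ?T = lie_of_tree
  have "lin_ext ?D (gen (Node r (Node s t)) + gen (Node s (Node t r)) + gen (Node t (Node r s)))
    = (lie_bracket (?D r) (lie_bracket (?T s) (?T t)) + lie_bracket (?T s) (lie_bracket (?T t) (?D r))
        + lie_bracket (?T t) (lie_bracket (?D r) (?T s)))
    + (lie_bracket (?T r) (lie_bracket (?D s) (?T t)) + lie_bracket (?D s) (lie_bracket (?T t) (?T r))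
        + lie_bracket (?T t) (lie_bracket (?T r) (?D s)))
    + (lie_bracket (?T r) (lie_bracket (?T s) (?D t)) + lie_bracket (?T s) (lie_bracket (?D t) (?T r))
        + lie_bracket (?D t) (lie_bracket (?T r) (?T s)))"
    by (simp add: lin_ext_add lie_of_tree_Node lie_bracket_add_right algebra_simps)
  then show ?case by (simp only: lie_bracket_jacobi add_0)
qed (simp_all add: lin_ext_add lin_ext_scale lin_ext_der_of_tree_Node abs_lie_eq_0)

lemma lie_derivation_linear: "lie_derivation D \<Longrightarrow> linearQ D"
  by (simp add: lie_derivation_def)

lemma lie_derivation_bracket:
  "lie_derivation D \<Longrightarrow> D (lie_bracket f g) = lie_bracket (D f) g + lie_bracket f (D g)"
  by (simp add: lie_derivation_def)

lemma lie_derivation_eqI: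
  assumes D: "lie_derivation D" and E: "lie_derivation E" and "D X0 = E X0" "D X1 = E X1"
  shows "D h = E h"
proof (induction h rule: lie_induct)
  case (tree t)
  show ?case
  proof (induction t)
    case (Leaf b)
    then show ?case using assms by (cases b) auto
  next
    case (Node s t)
    then show ?case
      by (simp add: lie_of_tree_Node lie_derivation_bracket[OF D] lie_derivation_bracket[OF E])
  qed
qed (simp_all add: rvp.linear_add[OF lie_derivation_linear] rvp.linear_scale[OF lie_derivation_linear] D E)

lemma ex_lie_derivation: "\<exists>D. lie_derivation D \<and> D X0 = 0 \<and> D X1 = lie_bracket X1 f"
proof -
  define D where "D h = lin_ext (der_of_tree f) (rep_lie h)" for h
  have D: "D (abs_lie p) = lin_ext (der_of_tree f) p" for p
  proof -
    have "lie_equiv (rep_lie (abs_lie p)) p"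
      using Quotient3_rep_abs[OF Quotient3_lie, of p] equivp_reflp[OF equivp_lie_equiv] by blast
    then show ?thesis
      using lin_ext_der_of_tree_ideal[of "rep_lie (abs_lie p) - p" f]
      by (simp add: lie_equiv_def lin_ext_diff D_def)
  qed
  have abs_cases: "\<exists>p. h = abs_lie p" for h by (metis Quotient3_abs_rep Quotient3_lie)
  have "linearQ D"
  proof (rule linearQI)
    fix x y c
    obtain p q where pq: "x = abs_lie p" "y = abs_lie q" using abs_cases by metis
    show "D (x + y) = D x + D y" by (simp only: pq D lin_ext_add flip: abs_lie_add)
    show "D (c *\<^sub>Q x) = c *\<^sub>Q D x" by (simp only: pq D lin_ext_scale flip: abs_lie_scale)
  qed
  moreover have "D (lie_bracket x y) = lie_bracket (D x) y + lie_bracket x (D y)" for x y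
  proof -
    obtain p q where pq: "x = abs_lie p" "y = abs_lie q" using abs_cases by metis
    have "lie_bracket x y = abs_lie (bilin_ext Node p q)" by (simp add: pq lie_bracket.abs_eq)
    then show ?thesis by (simp add: pq D lin_ext_der_of_tree_Node)
  qed
  moreover have "D X0 = 0" "D X1 = lie_bracket X1 f"
    by (simp_all add: D flip: abs_lie_gen)
  ultimately show ?thesis by (auto simp: lie_derivation_def)
qed

lemma der: "lie_derivation (der f) \<and> der f X0 = 0 \<and> der f X1 = lie_bracket X1 f"
proof -
  have "\<exists>!D. lie_derivation D \<and> D X0 = 0 \<and> D X1 = lie_bracket X1 f"
  proof (rule ex_ex1I[OF ex_lie_derivation[of f]])
    fix D E assume "lie_derivation D \<and> D X0 = 0 \<and> D X1 = lie_bracket X1 f"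
      "lie_derivation E \<and> E X0 = 0 \<and> E X1 = lie_bracket X1 f"
    then show "D = E" using lie_derivation_eqI[of D E] by auto
  qed
  from theI'[OF this] show ?thesis unfolding der_def .
qed

lemma lie_derivation_der: "lie_derivation (der f)"
  and der_X0 [simp]: "der f X0 = 0"
  and der_X1 [simp]: "der f X1 = lie_bracket X1 f"
  using der by auto

lemmas linear_der = lie_derivation_linear[OF lie_derivation_der]
lemmas der_bracket = lie_derivation_bracket[OF lie_derivation_der]
lemmas der_add_right = rvp.linear_add[OF linear_der]
lemmas der_diff_right = rvp.linear_diff[OF linear_der]
lemmas der_scale_right = rvp.linear_scale[OF linear_der]
lemmas der_zero_right [simp] = rvp.linear_0[OF linear_der]

lemma der_add_left: "der (f + g) h = der f h + der g h"
proof (rule lie_derivation_eqI[OF lie_derivation_der])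
  show "lie_derivation (\<lambda>h. der f h + der g h)"
    unfolding lie_derivation_def
    by (simp add: rvp.linear_compose_add linear_der der_bracket lie_bracket_add_left
      lie_bracket_add_right)
qed (simp_all add: lie_bracket_add_right)

lemma der_scale_left: "der (c *\<^sub>Q f) h = c *\<^sub>Q der f h"
proof (rule lie_derivation_eqI[OF lie_derivation_der])
  show "lie_derivation (\<lambda>h. c *\<^sub>Q der f h)"
    unfolding lie_derivation_def
    by (simp add: rvp.linear_compose_scale_right linear_der der_bracket scaleQ_add_right
      lie_bracket_scale_left lie_bracket_scale_right)
qed (simp_all add: lie_bracket_scale_right)

lemma linear_der_left: "linearQ (\<lambda>f. der f h)"
  by (intro linearQI der_add_left der_scale_left)

lemmas der_zero_left [simp] = rvp.linear_0[OF linear_der_left]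

lemma lie_derivation_commutator:
  assumes D: "lie_derivation D" and E: "lie_derivation E"
  shows "lie_derivation (\<lambda>h. D (E h) - E (D h))"
  unfolding lie_derivation_def
proof (intro conjI allI)
  note lins = rvp.linear_add[OF lie_derivation_linear] rvp.linear_scale[OF lie_derivation_linear]
  show "linearQ (\<lambda>h. D (E h) - E (D h))"
    by (rule linearQI) (simp_all add: lins D E rv.scale_right_diff_distrib)
  show "D (E (lie_bracket f g)) - E (D (lie_bracket f g))
      = lie_bracket (D (E f) - E (D f)) g + lie_bracket f (D (E g) - E (D g))" for f g
    by (simp add: lie_derivation_bracket[OF D] lie_derivation_bracket[OF E] lins D E
      lie_bracket_diff_left lie_bracket_diff_right)
qed

section \<open>The Lie algebra \<open>L_{1;x}\<close>\<close>

text \<open>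
  The Ihara bracket, which is the bracket of \<open>L_1\<close>.
\<close>

definition ihara :: "lie \<Rightarrow> lie \<Rightarrow> lie" where
  "ihara a b = lie_bracket a b + der a b - der b a"

lemma bracket_1x_ihara: "bracket_1x (a, f) (b, g) = (ihara a b, lie_bracket f g + der a g - der b f)"
  by (simp add: ihara_def)

text \<open>
  Both sides are derivations that vanish on \<open>X0\<close>, so they need only be compared on \<open>X1\<close>, where the
  claim is the Jacobi identity for \<open>X1\<close>, \<open>a\<close>, \<open>b\<close>. Thus \<open>L_1\<close> acts on \<open>L_x\<close> by derivations.
\<close>

lemma der_ihara: "der (ihara a b) h = der a (der b h) - der b (der a h)"
proof (rule lie_derivation_eqI[OF lie_derivation_der
    lie_derivation_commutator[OF lie_derivation_der lie_derivation_der]])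
  have "lie_bracket (lie_bracket X1 a) b
      = lie_bracket (lie_bracket X1 b) a + lie_bracket X1 (lie_bracket a b)"
    by (rule lie_bracket_leibniz_left)
  then show "der (ihara a b) X1 = der a (der b X1) - der b (der a X1)"
    by (simp add: ihara_def der_bracket lie_bracket_add_right lie_bracket_diff_right)
qed simp

lemma bracket_1x_antisym: "bracket_1x u v = - bracket_1x v u"
proof -
  obtain a f b g where "u = (a, f)" "v = (b, g)" by (metis surj_pair)
  then show ?thesis using lie_bracket_antisym[of a b] lie_bracket_antisym[of f g] by simp
qed

lemma linear_bracket_1x: "linearQ (\<lambda>u. bracket_1x u v)" "linearQ (bracket_1x u)"
proof -
  have add: "bracket_1x (u + u') v = bracket_1x u v + bracket_1x u' v"
    and scale: "bracket_1x (c *\<^sub>Q u) v = c *\<^sub>Q bracket_1x u v" for u u' v c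
    by (cases u; cases u'; cases v; simp add: scaleQ_prod_def lie_bracket_add_left der_add_left
        der_add_right lie_bracket_scale_left der_scale_left der_scale_right
        rv.scale_right_diff_distrib scaleQ_add_right)+
  show "linearQ (\<lambda>u. bracket_1x u v)"
    by (intro linearQI add scale)
  show "linearQ (bracket_1x u)"
  proof (rule linearQI)
    show "bracket_1x u (x + y) = bracket_1x u x + bracket_1x u y" for x y
      using add[of x y u] by (simp add: bracket_1x_antisym[of u])
    show "bracket_1x u (c *\<^sub>Q x) = c *\<^sub>Q bracket_1x u x" for c x
      using scale[of c x u] by (simp add: bracket_1x_antisym[of u])
  qed
qed

text \<open>
  Expand derivatives of brackets by the Leibniz rule and derivatives along a bracket by
  \<open>der_ihara\<close>. In the cyclic sum all terms that contain a derivative cancel, and the Jacobi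
  expressions of the free Lie algebra remain.
\<close>

lemma bracket_1x_jacobi:
  "bracket_1x (bracket_1x u v) w + bracket_1x (bracket_1x v w) u + bracket_1x (bracket_1x w u) v = 0"
proof -
  obtain a f b g c h where uvw: "u = (a, f)" "v = (b, g)" "w = (c, h)" by (metis surj_pair)
  have J: "lie_bracket (lie_bracket x y) z + lie_bracket (lie_bracket y z) x
      + lie_bracket (lie_bracket z x) y = 0" for x y z
  proof -
    have "lie_bracket (lie_bracket x y) z + lie_bracket (lie_bracket y z) x
        + lie_bracket (lie_bracket z x) y
      = - (lie_bracket z (lie_bracket x y) + lie_bracket x (lie_bracket y z)
        + lie_bracket y (lie_bracket z x))"
      unfolding lie_bracket_antisym[of "lie_bracket x y" z]
        lie_bracket_antisym[of "lie_bracket y z" x] lie_bracket_antisym[of "lie_bracket z x" y]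
      by simp
    then show ?thesis by (simp only: lie_bracket_jacobi neg_0_equal_iff_equal minus_zero)
  qed
  note exp = lie_bracket_add_left lie_bracket_diff_left der_add_right der_diff_right der_bracket
    der_ihara
  \<comment> \<open>Normal form in which the differentiated factor stands on the left.\<close>
  note flip = lie_bracket_antisym[of a "der _ _"] lie_bracket_antisym[of b "der _ _"]
    lie_bracket_antisym[of c "der _ _"] lie_bracket_antisym[of f "der _ _"]
    lie_bracket_antisym[of g "der _ _"] lie_bracket_antisym[of h "der _ _"]
  have 1: "ihara (ihara a b) c + ihara (ihara b c) a + ihara (ihara c a) b = 0"
  proof -
    have "ihara (ihara a b) c + ihara (ihara b c) a + ihara (ihara c a) b
      = lie_bracket (lie_bracket a b) c + lie_bracket (lie_bracket b c) a
      + lie_bracket (lie_bracket c a) b"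
      unfolding ihara_def[of "ihara _ _"] der_ihara unfolding ihara_def
      by (simp add: exp flip)
    then show ?thesis by (simp only: J)
  qed
  have 2: "(lie_bracket (lie_bracket f g + der a g - der b f) h + der (ihara a b) h
        - der c (lie_bracket f g + der a g - der b f))
      + (lie_bracket (lie_bracket g h + der b h - der c g) f + der (ihara b c) f
        - der a (lie_bracket g h + der b h - der c g))
      + (lie_bracket (lie_bracket h f + der c f - der a h) g + der (ihara c a) g
        - der b (lie_bracket h f + der c f - der a h)) = 0" (is "?l = 0")
  proof -
    have "?l = lie_bracket (lie_bracket f g) h + lie_bracket (lie_bracket g h) f
      + lie_bracket (lie_bracket h f) g"
      by (simp add: exp flip)
    then show ?thesis by (simp only: J)
  qed
  show ?thesis
    using 1 2 by (simp only: uvw bracket_1x_ihara add_Pair zero_prod_def)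
qed

lemma lie_bracket_grade:
  assumes "f \<in> lie_grade m" "g \<in> lie_grade n"
  shows "lie_bracket f g \<in> lie_grade (m + n)"
  unfolding lie_grade_def
proof (rule span_bilinear_image[OF linear_lie_bracket_left linear_lie_bracket_right _
      assms[unfolded lie_grade_def]])
  fix a b assume "a \<in> {lie_of_tree t |t. leaves t = m}" "b \<in> {lie_of_tree t |t. leaves t = n}"
  then obtain s t where "a = lie_of_tree s" "b = lie_of_tree t" "leaves s = m" "leaves t = n"
    by auto
  then have "lie_bracket a b = lie_of_tree (Node s t)" "leaves (Node s t) = m + n"
    by (auto simp: lie_of_tree_Node)
  then show "lie_bracket a b \<in> rv.span {lie_of_tree t |t. leaves t = m + n}"
    by (metis (mono_tags, lifting) mem_Collect_eq rv.span_base)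
qed

lemma lie_grade_add: "f \<in> lie_grade n \<Longrightarrow> g \<in> lie_grade n \<Longrightarrow> f + g \<in> lie_grade n"
  and lie_grade_diff: "f \<in> lie_grade n \<Longrightarrow> g \<in> lie_grade n \<Longrightarrow> f - g \<in> lie_grade n"
  and lie_grade_zero: "0 \<in> lie_grade n"
  unfolding lie_grade_def by (auto intro: rv.span_add rv.span_diff rv.span_zero)

lemma lie_of_tree_grade: "lie_of_tree t \<in> lie_grade (leaves t)"
  unfolding lie_grade_def by (rule rv.span_base) auto

lemma der_grade:
  assumes f: "f \<in> lie_grade m" and "g \<in> lie_grade n"
  shows "der f g \<in> lie_grade (m + n)"
proof -
  have tree: "der f (lie_of_tree t) \<in> lie_grade (m + leaves t)" for t
  proof (induction t)
    case (Leaf b)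
    then show ?case
      using lie_bracket_grade[OF lie_of_tree_grade[of "Leaf True"] f]
      by (cases b) (auto simp: lie_grade_zero add.commute)
  next
    case (Node s t)
    have "lie_bracket (der f (lie_of_tree s)) (lie_of_tree t) \<in> lie_grade (m + leaves s + leaves t)"
      "lie_bracket (lie_of_tree s) (der f (lie_of_tree t)) \<in> lie_grade (leaves s + (m + leaves t))"
      using Node lie_bracket_grade lie_of_tree_grade by blast+
    then show ?case
      by (simp add: lie_of_tree_Node der_bracket lie_grade_add ac_simps)
  qed
  show ?thesis
    unfolding lie_grade_def
    by (rule span_linear_image[OF linear_der _ assms(2)[unfolded lie_grade_def]])
      (use tree in \<open>auto simp: lie_grade_def\<close>)
qed

lemma bracket_1x_grade:
  assumes "u \<in> grade_1x m" "v \<in> grade_1x n"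
  shows "bracket_1x u v \<in> grade_1x (m + n)"
proof -
  obtain a f b g where *: "u = (a, f)" "v = (b, g)" by (metis surj_pair)
  have **: "a \<in> lie_grade m" "f \<in> lie_grade m" "b \<in> lie_grade n" "g \<in> lie_grade n"
    using assms by (auto simp: * grade_1x_def)
  then have "der b a \<in> lie_grade (m + n)" "der b f \<in> lie_grade (m + n)"
    by (metis der_grade add.commute)+
  then show ?thesis using **
    by (auto simp: * grade_1x_def intro!: lie_grade_add lie_grade_diff lie_bracket_grade der_grade)
qed

lemma lyndon_bracket_grade: "lyndon W \<Longrightarrow> lyndon_bracket W \<in> lie_grade (length W)"
proof (induction "length W" arbitrary: W rule: less_induct)
  case less
  show ?case
  proof (cases "length W = 1")
    case True
    then obtain b where "W = [b]" by (auto simp: length_Suc_conv)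
    then show ?thesis
      using lie_of_tree_grade[of "Leaf b"] by (simp add: lyndon_bracket.simps[of "[b]"])
  next
    case False
    have len: "2 \<le> length W"
      using False lyndon_nonempty[OF less.prems] by (cases W) (auto simp: Suc_le_eq)
    note split = left_cofactor_append[OF len, THEN arg_cong, of length, unfolded length_append]
    have pos: "0 < length (left_cofactor W)" "0 < length (min_right_factor W)"
      using left_cofactor_nonempty[OF len] min_right_factor(1)[OF len] by auto
    then have lens: "length (left_cofactor W) < length W" "length (min_right_factor W) < length W"
      using split by linarith+
    have "lyndon_bracket (left_cofactor W) \<in> lie_grade (length (left_cofactor W))"
      "lyndon_bracket (min_right_factor W) \<in> lie_grade (length (min_right_factor W))"
      using lens lyndon_left_cofactor[OF less.prems len] lyndon_min_right_factor[OF len]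
      by (auto intro!: less.hyps)
    from lie_bracket_grade[OF this] show ?thesis
      by (simp add: lyndon_bracket_std[OF len] split)
  qed
qed

section \<open>Wedge products and exterior powers\<close>

lemma ext_equiv_refl: "ext_equiv p p"
  by (simp add: ext_equiv_def ext_ideal_zero)

lemma wedge_add_left: "(a + a') \<and>\<^sub>E b = (a \<and>\<^sub>E b) + (a' \<and>\<^sub>E b)"
  by transfer (simp add: bilin_ext_add_left ext_equiv_refl)

lemma wedge_add_right: "a \<and>\<^sub>E (b + b') = (a \<and>\<^sub>E b) + (a \<and>\<^sub>E b')"
  by transfer (simp add: bilin_ext_add_right ext_equiv_refl)

lemma wedge_scale_left: "(c *\<^sub>Q a) \<and>\<^sub>E b = c *\<^sub>Q (a \<and>\<^sub>E b)"
  by transfer (simp add: bilin_ext_scale_left ext_equiv_refl)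

lemma wedge_scale_right: "a \<and>\<^sub>E (c *\<^sub>Q b) = c *\<^sub>Q (a \<and>\<^sub>E b)"
  by transfer (simp add: bilin_ext_scale_right ext_equiv_refl)

lemma wedge_assoc: "(a \<and>\<^sub>E b) \<and>\<^sub>E c = a \<and>\<^sub>E (b \<and>\<^sub>E c)"
  by transfer (simp add: bilin_ext_append_assoc ext_equiv_refl)

lemma linear_wedge_left: "linearQ (\<lambda>a. a \<and>\<^sub>E b)"
  by (intro linearQI wedge_add_left wedge_scale_left)

lemma linear_wedge_right: "linearQ (\<lambda>b. a \<and>\<^sub>E b)"
  by (intro linearQI wedge_add_right wedge_scale_right)

lemmas wedge_zero_left [simp] = rvp.linear_0[OF linear_wedge_left]
lemmas wedge_zero_right [simp] = rvp.linear_0[OF linear_wedge_right]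
lemmas wedge_uminus_left = rvp.linear_neg[OF linear_wedge_left]
lemmas wedge_uminus_right = rvp.linear_neg[OF linear_wedge_right]
lemmas wedge_diff_left = rvp.linear_diff[OF linear_wedge_left]
lemmas wedge_sum_left = rvp.linear_sum[OF linear_wedge_left]
lemmas wedge_sum_right = rvp.linear_sum[OF linear_wedge_right]

lemma ext_of_list_append: "ext_of_list (xs @ ys) = ext_of_list xs \<and>\<^sub>E ext_of_list ys"
  by transfer (simp add: ext_equiv_refl)

lemma ext_of_list_Cons: "ext_of_list (x # xs) = ext_incl x \<and>\<^sub>E ext_of_list xs"
  using ext_of_list_append[of "[x]" xs] by (simp add: ext_incl_def)

lemma ext_incl_add: "ext_incl (x + y) = ext_incl x + ext_incl y"
  unfolding ext_incl_def by transfer (simp add: ext_equiv_def ext_ideal.gen_add)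

lemma ext_incl_scale: "ext_incl (c *\<^sub>Q x) = c *\<^sub>Q ext_incl x"
  unfolding ext_incl_def by transfer (simp add: ext_equiv_def ext_ideal.gen_scale)

lemma linear_ext_incl: "linearQ ext_incl"
  by (intro linearQI ext_incl_add ext_incl_scale)

lemma ext_incl_square [simp]: "ext_incl x \<and>\<^sub>E ext_incl x = 0"
proof -
  have "ext_of_list [x, x] = 0"
    by transfer (simp add: ext_equiv_def ext_ideal.square)
  then show ?thesis by (simp add: ext_of_list_append[of "[x]" "[x]", simplified] ext_incl_def)
qed

lemma ext_incl_anticomm: "ext_incl x \<and>\<^sub>E ext_incl y = - (ext_incl y \<and>\<^sub>E ext_incl x)"
proof -
  have "ext_incl (x + y) \<and>\<^sub>E ext_incl (x + y) = 0" by (rule ext_incl_square)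
  then show ?thesis
    by (simp add: ext_incl_add wedge_add_left wedge_add_right eq_neg_iff_add_eq_0 add.commute)
qed

lemma abs_ext_gen: "abs_ext (gen xs) = ext_of_list xs"
  by (simp add: ext_of_list.abs_eq)

lemma abs_ext_add: "abs_ext (p + q) = abs_ext p + abs_ext q"
  by (simp add: plus_ext.abs_eq)

lemma abs_ext_scale: "abs_ext (c *\<^sub>Q p) = c *\<^sub>Q abs_ext p"
  by (simp add: scaleQ_ext.abs_eq)

lemma abs_ext_eq_0: "p \<in> ext_ideal \<Longrightarrow> abs_ext p = 0"
  by (simp add: zero_ext_def ext.abs_eq_iff ext_equiv_def)

lemma abs_ext_cases: "\<exists>p. \<omega> = abs_ext p"
  by (metis Quotient3_abs_rep Quotient3_ext)

lemma ext_induct [case_names list add scale]: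
  assumes "\<And>xs. P (ext_of_list xs)"
    and "\<And>a b. P a \<Longrightarrow> P b \<Longrightarrow> P (a + b)"
    and "\<And>c a. P a \<Longrightarrow> P (c *\<^sub>Q a)"
  shows "P \<omega>"
proof -
  have "P (abs_ext p)" for p
    by (induction p rule: gen_induct)
      (auto simp: assms abs_ext_gen abs_ext_add abs_ext_scale)
  then show ?thesis using abs_ext_cases by metis
qed

lemma ext_one_left [simp]: "ext_of_list [] \<and>\<^sub>E a = a"
  and ext_one_right [simp]: "a \<and>\<^sub>E ext_of_list [] = a"
proof -
  show "ext_of_list [] \<and>\<^sub>E a = a"
    by (induction a rule: ext_induct)
      (simp_all add: wedge_add_right wedge_scale_right flip: ext_of_list_append)
  show "a \<and>\<^sub>E ext_of_list [] = a"
    by (induction a rule: ext_induct)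
      (simp_all add: wedge_add_left wedge_scale_left flip: ext_of_list_append)
qed

lemma ext_power_of_list: "length xs = p \<Longrightarrow> ext_of_list xs \<in> ext_power p"
  unfolding ext_power_def by (rule rv.span_base) auto

lemma ext_power_incl: "ext_incl x \<in> ext_power 1"
  by (simp add: ext_incl_def ext_power_of_list)

lemma ext_power_2_incl: "ext_incl x \<and>\<^sub>E ext_incl y \<in> ext_power 2"
  using ext_power_of_list[of "[x, y]" 2] by (simp add: ext_of_list_Cons)

lemma ext_power_add: "a \<in> ext_power p \<Longrightarrow> b \<in> ext_power p \<Longrightarrow> a + b \<in> ext_power p"
  and ext_power_scale: "a \<in> ext_power p \<Longrightarrow> c *\<^sub>Q a \<in> ext_power p"
  and ext_power_sum: "(\<And>i. i \<in> I \<Longrightarrow> f i \<in> ext_power p) \<Longrightarrow> sum f I \<in> ext_power p"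
  unfolding ext_power_def by (auto intro: rv.span_add rv.span_scale rv.span_sum)

lemma ext_power_induct [consumes 1, case_names list add scale]:
  assumes "\<omega> \<in> ext_power p"
    and list: "\<And>xs. length xs = p \<Longrightarrow> P (ext_of_list xs)"
    and add: "\<And>a b. P a \<Longrightarrow> P b \<Longrightarrow> P (a + b)"
    and scale: "\<And>c a. P a \<Longrightarrow> P (c *\<^sub>Q a)"
  shows "P \<omega>"
  using assms(1) unfolding ext_power_def
proof (induction rule: rv.span_induct_alt)
  case base
  show ?case using scale[OF list[of "replicate p undefined"], of 0] by simp
qed (use list add scale in auto)

lemma ext_power_2_induct [consumes 1, case_names wedge add scale]:
  assumes "\<omega> \<in> ext_power 2"
    and wedge: "\<And>x y. P (ext_incl x \<and>\<^sub>E ext_incl y)"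
    and add: "\<And>a b. P a \<Longrightarrow> P b \<Longrightarrow> P (a + b)"
    and scale: "\<And>c a. P a \<Longrightarrow> P (c *\<^sub>Q a)"
  shows "P \<omega>"
  using assms(1)
proof (induction rule: ext_power_induct)
  case (list xs)
  then obtain x y where "xs = [x, y]" by (auto simp: numeral_2_eq_2 length_Suc_conv)
  then show ?case using wedge by (simp add: ext_of_list_Cons)
qed (use add scale in auto)

text \<open>
  Moving \<open>z\<close> past two factors costs two signs.
\<close>

lemma ext_power_2_commute:
  assumes "\<omega> \<in> ext_power 2"
  shows "\<omega> \<and>\<^sub>E ext_incl z = ext_incl z \<and>\<^sub>E \<omega>"
  using assms
proof (induction rule: ext_power_2_induct)
  case (wedge x y)
  have "(ext_incl x \<and>\<^sub>E ext_incl y) \<and>\<^sub>E ext_incl z = - ((ext_incl x \<and>\<^sub>E ext_incl z) \<and>\<^sub>E ext_incl y)"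
    using ext_incl_anticomm[of y z] by (simp add: wedge_assoc wedge_uminus_right)
  also have "\<dots> = ext_incl z \<and>\<^sub>E (ext_incl x \<and>\<^sub>E ext_incl y)"
    using ext_incl_anticomm[of x z] by (simp add: wedge_assoc wedge_uminus_left)
  finally show ?case .
qed (simp_all add: wedge_add_left wedge_add_right wedge_scale_left wedge_scale_right)

section \<open>Antiderivations of exterior algebras\<close>

fun antider_list :: "('v::rat_vector \<Rightarrow> 'v ext) \<Rightarrow> 'v list \<Rightarrow> 'v ext" where
  "antider_list \<delta> [] = 0"
| "antider_list \<delta> (x # xs) = (\<delta> x \<and>\<^sub>E ext_of_list xs) - (ext_incl x \<and>\<^sub>E antider_list \<delta> xs)"

lemma antider_list_append:
  "antider_list \<delta> (xs @ ys) = (antider_list \<delta> xs \<and>\<^sub>E ext_of_list ys)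
    + (- 1) ^ length xs *\<^sub>Q (ext_of_list xs \<and>\<^sub>E antider_list \<delta> ys)"
proof (induction xs)
  case Nil
  then show ?case by simp
next
  case (Cons x xs)
  then show ?case
    by (simp add: ext_of_list_append ext_of_list_Cons wedge_assoc wedge_add_right wedge_diff_left
      wedge_scale_right)
qed

text \<open>
  The parity automorphism, which is \<open>(-1)\<^sup>p\<close> in degree \<open>p\<close>. It extends the graded Leibniz rule to
  inhomogeneous elements of the free associative algebra, and these occur in the ideal of
  relations.
\<close>

definition sign_list :: "'v::rat_vector list \<Rightarrow> 'v ext" where
  "sign_list xs = (- 1) ^ length xs *\<^sub>Q ext_of_list xs"

lemma lin_ext_sign_list_append:
  "lin_ext sign_list (bilin_ext (@) p q) = lin_ext sign_list p \<and>\<^sub>E lin_ext sign_list q"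
proof -
  note lins = lin_ext_add lin_ext_scale bilin_ext_add_left bilin_ext_add_right
    bilin_ext_scale_left bilin_ext_scale_right wedge_add_left wedge_add_right
    wedge_scale_left wedge_scale_right
  have 1: "lin_ext sign_list (bilin_ext (@) (gen xs) q)
      = lin_ext sign_list (gen xs) \<and>\<^sub>E lin_ext sign_list q" for xs :: "'a list"
  proof (induction q rule: gen_induct)
    case (gen ys)
    show ?case
      by (simp add: sign_list_def ext_of_list_append wedge_scale_left wedge_scale_right power_add
        scaleQ_scaleQ)
  qed (simp_all only: lins)
  show ?thesis by (induction p rule: gen_induct) (simp_all only: 1 lins)
qed

lemma lin_ext_antider_list_append:
  "lin_ext (antider_list \<delta>) (bilin_ext (@) p q)
    = (lin_ext (antider_list \<delta>) p \<and>\<^sub>E abs_ext q) + (lin_ext sign_list p \<and>\<^sub>E lin_ext (antider_list \<delta>) q)"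
proof -
  note lins = lin_ext_add lin_ext_scale bilin_ext_add_left bilin_ext_add_right
    bilin_ext_scale_left bilin_ext_scale_right wedge_add_left wedge_add_right
    wedge_scale_left wedge_scale_right abs_ext_gen abs_ext_add abs_ext_scale scaleQ_add_right
  have 1: "lin_ext (antider_list \<delta>) (bilin_ext (@) (gen xs) q)
    = (lin_ext (antider_list \<delta>) (gen xs) \<and>\<^sub>E abs_ext q)
      + (lin_ext sign_list (gen xs) \<and>\<^sub>E lin_ext (antider_list \<delta>) q)" for xs
  proof (induction q rule: gen_induct)
    case (gen ys)
    show ?case by (simp add: sign_list_def abs_ext_gen antider_list_append wedge_scale_left)
  next
    case (add p q)
    then show ?case by (simp only: lins) (simp add: algebra_simps)
  next
    case (scale c q)
    then show ?case by (simp only: lins)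
  qed
  show ?thesis
  proof (induction p rule: gen_induct)
    case (gen xs)
    show ?case by (rule 1)
  next
    case (add p q)
    then show ?case by (simp only: lins) (simp add: algebra_simps)
  next
    case (scale c q)
    then show ?case by (simp only: lins)
  qed
qed

text \<open>
  The relation \<open>x \<and> x = 0\<close> is respected because \<open>\<delta> x\<close> has even degree and so commutes with \<open>x\<close>. The
  parity automorphism is carried along for products, where it multiplies the second
  summand of the Leibniz rule.
\<close>

lemma lin_ext_antider_list_ideal:
  assumes lin: "linearQ \<delta>" and deg: "\<And>x. \<delta> x \<in> ext_power 2" and "p \<in> ext_ideal"
  shows "lin_ext (antider_list \<delta>) p = 0 \<and> lin_ext sign_list p = 0"
proof -
  have sign_single: "sign_list [x] = - ext_incl x" for x :: 'a
    by (simp add: sign_list_def ext_incl_def)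
  show ?thesis
    using assms(3)
  proof (induction rule: ext_ideal.induct)
    case (square x)
    then show ?case
      using ext_power_2_commute[OF deg, of x x] ext_incl_square[of x]
      by (simp add: sign_list_def ext_of_list_Cons)
  qed (simp_all add: lin_ext_add lin_ext_diff lin_ext_scale sign_single rvp.linear_add[OF lin]
      rvp.linear_scale[OF lin] lin_ext_antider_list_append lin_ext_sign_list_append abs_ext_eq_0
      ext_incl_add ext_incl_scale ext_of_list_Cons rv.scale_left_commute)
qed

lemma leibniz_extensionD:
  assumes "leibniz_extension \<delta> d"
  shows "linearQ d" "d (ext_incl x) = \<delta> x"
    "a \<in> ext_power p \<Longrightarrow> d (a \<and>\<^sub>E b) = (d a \<and>\<^sub>E b) + (- 1) ^ p *\<^sub>Q (a \<and>\<^sub>E d b)"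
  using assms by (auto simp: leibniz_extension_def)

lemma ex_leibniz_extension:
  fixes \<delta> :: "'v::rat_vector \<Rightarrow> 'v ext"
  assumes lin: "linearQ \<delta>" and deg: "\<And>x. \<delta> x \<in> ext_power 2"
  shows "\<exists>d. leibniz_extension \<delta> d"
proof -
  define d where "d \<omega> = lin_ext (antider_list \<delta>) (rep_ext \<omega>)" for \<omega>
  have d: "d (abs_ext p) = lin_ext (antider_list \<delta>) p" for p
  proof -
    have "ext_equiv (rep_ext (abs_ext p)) p"
      using Quotient3_rep_abs[OF Quotient3_ext, of p] ext_equiv_refl by blast
    then show ?thesis
      using lin_ext_antider_list_ideal[OF assms, of "rep_ext (abs_ext p) - p"]
      by (simp add: ext_equiv_def lin_ext_diff d_def)
  qed
  have linear: "linearQ d"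
  proof (rule linearQI)
    fix x y :: "'v ext" and c
    obtain p q where pq: "x = abs_ext p" "y = abs_ext q" using abs_ext_cases by metis
    show "d (x + y) = d x + d y" by (simp only: pq d lin_ext_add flip: abs_ext_add)
    show "d (c *\<^sub>Q x) = c *\<^sub>Q d x" by (simp only: pq d lin_ext_scale flip: abs_ext_scale)
  qed
  have d_list: "d (ext_of_list xs) = antider_list \<delta> xs" for xs
    by (simp add: d flip: abs_ext_gen)
  have "d (a \<and>\<^sub>E b) = (d a \<and>\<^sub>E b) + (- 1) ^ p *\<^sub>Q (a \<and>\<^sub>E d b)" if "a \<in> ext_power p" for p a b
    using that
  proof (induction rule: ext_power_induct)
    case (list xs)
    show ?case
    proof (induction b rule: ext_induct)
      case (list ys)
      show ?case
        using antider_list_append[of \<delta> xs ys] \<open>length xs = p\<close>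
        by (simp add: d_list flip: ext_of_list_append)
    next
      case (add a b)
      then show ?case
        by (simp add: wedge_add_right rvp.linear_add[OF linear] scaleQ_add_right)
    next
      case (scale c a)
      then show ?case
        by (simp add: wedge_scale_right rvp.linear_scale[OF linear] scaleQ_add_right
          rv.scale_left_commute)
    qed
  next
    case (add a a')
    then show ?case by (simp add: wedge_add_left rvp.linear_add[OF linear] scaleQ_add_right)
  next
    case (scale c a)
    then show ?case
      by (simp add: wedge_scale_left rvp.linear_scale[OF linear] scaleQ_add_right
        rv.scale_left_commute)
  qed
  moreover have "d (ext_incl x) = \<delta> x" for x
    by (simp add: ext_incl_def d_list)
  ultimately have "leibniz_extension \<delta> d" using linear by (simp add: leibniz_extension_def)
  then show ?thesis by blast
qed

lemma leibniz_extension_one: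
  assumes "leibniz_extension \<delta> d"
  shows "d (ext_of_list []) = 0"
  using leibniz_extensionD(3)[OF assms ext_power_of_list[of "[]" 0], of "ext_of_list []"] by simp

lemma leibniz_extension_Cons:
  assumes "leibniz_extension \<delta> d"
  shows "d (ext_of_list (x # xs)) = (\<delta> x \<and>\<^sub>E ext_of_list xs) - (ext_incl x \<and>\<^sub>E d (ext_of_list xs))"
  using leibniz_extensionD[OF assms] ext_power_incl[of x] by (simp add: ext_of_list_Cons)

lemma leibniz_extension_unique:
  assumes d: "leibniz_extension \<delta> d" and d': "leibniz_extension \<delta> d'"
  shows "d = d'"
proof
  fix \<omega>
  show "d \<omega> = d' \<omega>"
  proof (induction \<omega> rule: ext_induct)
    case (list xs)
    show ?case
      by (induction xs)
        (simp_all add: leibniz_extension_one[OF d] leibniz_extension_one[OF d']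
          leibniz_extension_Cons[OF d] leibniz_extension_Cons[OF d'])
  qed (simp_all add: leibniz_extensionD(1)[OF d, THEN rvp.linear_add]
      leibniz_extensionD(1)[OF d', THEN rvp.linear_add]
      leibniz_extensionD(1)[OF d, THEN rvp.linear_scale]
      leibniz_extensionD(1)[OF d', THEN rvp.linear_scale])
qed

text \<open>
  The square of an antiderivation obeys the Leibniz rule without signs: the two cross terms cancel
  because \<open>d\<close> changes the parity of the first factor.
\<close>

lemma leibniz_extension_square_zero:
  assumes d: "leibniz_extension \<delta> d" and deg: "\<And>x. \<delta> x \<in> ext_power 2"
    and sq: "\<And>x. d (\<delta> x) = 0"
  shows "d (d \<omega>) = 0"
proof -
  note lin = leibniz_extensionD(1)[OF d]
  show ?thesis
  proof (induction \<omega> rule: ext_induct)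
    case (list xs)
    show ?case
    proof (induction xs)
      case Nil
      then show ?case by (simp add: leibniz_extension_one[OF d] rvp.linear_0[OF lin])
    next
      case (Cons x xs)
      then show ?case
        using leibniz_extensionD(3)[OF d deg, of x "ext_of_list xs"]
          leibniz_extensionD(3)[OF d ext_power_incl, of x "d (ext_of_list xs)"]
        by (simp add: leibniz_extension_Cons[OF d] rvp.linear_diff[OF lin] sq
          leibniz_extensionD(2)[OF d])
    qed
  qed (simp_all add: rvp.linear_add[OF lin] rvp.linear_scale[OF lin])
qed

section \<open>The dual basis\<close>

text \<open>
  The coordinate functions of the Lyndon basis; \<open>T_x\<close> and \<open>T_1\<close> are their pullbacks along the two
  projections of \<open>L_{1;x}\<close>.
\<close>

definition lyndon_coord :: "word \<Rightarrow> lie \<Rightarrow> rat" where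
  "lyndon_coord W f = rv.representation {lyndon_bracket V | V. lyndon V} f (lyndon_bracket W)"

lemma linear_lyndon_coord: "linearQ (lyndon_coord W)"
  unfolding lyndon_coord_def
  by (rule linearQI)
    (simp_all add: rv.representation_add rv.representation_scale lyndon_brackets_independent
      lyndon_brackets_span scaleQ_rat_def)

lemma lyndon_coord_lyndon_bracket:
  assumes "lyndon V" "lyndon W"
  shows "lyndon_coord W (lyndon_bracket V) = of_bool (V = W)"
proof -
  have "lyndon_bracket W = lyndon_bracket V \<longleftrightarrow> V = W"
    using assms inj_on_lyndon_bracket by (auto simp: inj_on_def)
  moreover have "rv.representation {lyndon_bracket V | V. lyndon V} (lyndon_bracket V)
      = (\<lambda>v. if v = lyndon_bracket V then 1 else 0)"
    using assms by (intro rv.representation_basis lyndon_brackets_independent) auto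
  ultimately show ?thesis by (simp add: lyndon_coord_def)
qed

lemma lyndon_coord_grade:
  assumes W: "lyndon W" and f: "f \<in> lie_grade n" and n: "n \<noteq> length W"
  shows "lyndon_coord W f = 0"
proof -
  have "f \<in> rv.span (lyndon_brackets_of_length n)" using f lie_grade_subset_lyndon_span by blast
  then show ?thesis
    by (induction rule: rv.span_induct_alt)
      (use W n in \<open>auto simp: rvp.linear_0[OF linear_lyndon_coord] rvp.linear_add[OF linear_lyndon_coord]
        rvp.linear_scale[OF linear_lyndon_coord] lyndon_coord_lyndon_bracket scaleQ_rat_def\<close>)
qed

lemma at_1_add_at_x: "v = at_1 (fst v) + at_x (snd v)"
  by (simp add: at_1_def at_x_def)

lemma linear_at_1: "linearQ at_1" and linear_at_x: "linearQ at_x"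
  by (auto intro!: linearQI simp: at_1_def at_x_def scaleQ_prod_def)

lemma linear_eq_on_lyndon:
  assumes f: "linearQ f" and g: "linearQ g"
    and x: "\<And>V. lyndon V \<Longrightarrow> f (at_x (lyndon_bracket V)) = g (at_x (lyndon_bracket V))"
    and 1: "\<And>V. lyndon V \<Longrightarrow> f (at_1 (lyndon_bracket V)) = g (at_1 (lyndon_bracket V))"
  shows "f v = g v"
proof -
  have "(f \<circ> at_x) h = (g \<circ> at_x) h" for h
    by (rule rvp.linear_eq_on_span[OF Vector_Spaces.linear_compose[OF linear_at_x f]
          Vector_Spaces.linear_compose[OF linear_at_x g], of "{lyndon_bracket V | V. lyndon V}"])
      (use x in \<open>auto simp: lyndon_brackets_span\<close>)
  moreover have "(f \<circ> at_1) h = (g \<circ> at_1) h" for h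
    by (rule rvp.linear_eq_on_span[OF Vector_Spaces.linear_compose[OF linear_at_1 f]
          Vector_Spaces.linear_compose[OF linear_at_1 g], of "{lyndon_bracket V | V. lyndon V}"])
      (use 1 in \<open>auto simp: lyndon_brackets_span\<close>)
  ultimately show ?thesis
    using at_1_add_at_x[of v] rvp.linear_add[OF f] rvp.linear_add[OF g] by (metis comp_apply)
qed

lemma linear_app_dual: "linearQ (app_dual \<phi>)"
  using app_dual[of \<phi>] by simp

lemma linear_app_dual_left: "linearQ (\<lambda>\<phi>. app_dual \<phi> v)"
  by (rule linearQI) (simp_all add: plus_dual_1x.rep_eq scaleQ_dual_1x.rep_eq)

lemma dual_eqI_lyndon:
  assumes "\<And>V. lyndon V \<Longrightarrow> app_dual \<phi> (at_x (lyndon_bracket V)) = app_dual \<psi> (at_x (lyndon_bracket V))"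
    and "\<And>V. lyndon V \<Longrightarrow> app_dual \<phi> (at_1 (lyndon_bracket V)) = app_dual \<psi> (at_1 (lyndon_bracket V))"
  shows "\<phi> = \<psi>"
  unfolding app_dual_inject[symmetric]
  by (rule ext, rule linear_eq_on_lyndon[OF linear_app_dual linear_app_dual assms])

lemma app_dual_Abs_coord:
  assumes W: "lyndon W"
  shows "app_dual (Abs_dual_1x (\<lambda>v. lyndon_coord W (snd v))) v = lyndon_coord W (snd v)"
    and "app_dual (Abs_dual_1x (\<lambda>v. lyndon_coord W (fst v))) v = lyndon_coord W (fst v)"
proof -
  have "linearQ (\<lambda>v. lyndon_coord W (snd v))" "linearQ (\<lambda>v. lyndon_coord W (fst v))"
    by (auto intro!: linearQI simp: rvp.linear_add[OF linear_lyndon_coord]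
        rvp.linear_scale[OF linear_lyndon_coord] scaleQ_prod_def)
  moreover have "finite {n. \<exists>v\<in>grade_1x n. lyndon_coord W (snd v) \<noteq> 0}"
    "finite {n. \<exists>v\<in>grade_1x n. lyndon_coord W (fst v) \<noteq> 0}"
    by (rule finite_subset[of _ "{length W}"]; use lyndon_coord_grade[OF W] in
        \<open>fastforce simp: grade_1x_def\<close>)+
  ultimately show "app_dual (Abs_dual_1x (\<lambda>v. lyndon_coord W (snd v))) v = lyndon_coord W (snd v)"
    "app_dual (Abs_dual_1x (\<lambda>v. lyndon_coord W (fst v))) v = lyndon_coord W (fst v)"
    by (subst Abs_dual_1x_inverse; simp)+
qed

lemma app_dual_T_x:
  assumes W: "lyndon W"
  shows "app_dual (T_x W) v = lyndon_coord W (snd v)"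
proof -
  have "T_x W = Abs_dual_1x (\<lambda>v. lyndon_coord W (snd v))"
    unfolding T_x_def
  proof (rule the_equality)
    show "\<forall>V. lyndon V \<longrightarrow>
      app_dual (Abs_dual_1x (\<lambda>v. lyndon_coord W (snd v))) (at_x (lyndon_bracket V)) = of_bool (V = W) \<and>
      app_dual (Abs_dual_1x (\<lambda>v. lyndon_coord W (snd v))) (at_1 (lyndon_bracket V)) = 0"
      by (simp add: app_dual_Abs_coord[OF W] at_x_def at_1_def lyndon_coord_lyndon_bracket W
        rvp.linear_0[OF linear_lyndon_coord])
    then show "\<phi> = Abs_dual_1x (\<lambda>v. lyndon_coord W (snd v))"
      if "\<forall>V. lyndon V \<longrightarrow> app_dual \<phi> (at_x (lyndon_bracket V)) = of_bool (V = W) \<and>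
        app_dual \<phi> (at_1 (lyndon_bracket V)) = 0" for \<phi>
      using that by (intro dual_eqI_lyndon) auto
  qed
  then show ?thesis by (simp add: app_dual_Abs_coord[OF W])
qed

lemma app_dual_T_1:
  assumes W: "lyndon W"
  shows "app_dual (T_1 W) v = lyndon_coord W (fst v)"
proof -
  have "T_1 W = Abs_dual_1x (\<lambda>v. lyndon_coord W (fst v))"
    unfolding T_1_def
  proof (rule the_equality)
    show "\<forall>V. lyndon V \<longrightarrow>
      app_dual (Abs_dual_1x (\<lambda>v. lyndon_coord W (fst v))) (at_1 (lyndon_bracket V)) = of_bool (V = W) \<and>
      app_dual (Abs_dual_1x (\<lambda>v. lyndon_coord W (fst v))) (at_x (lyndon_bracket V)) = 0"
      by (simp add: app_dual_Abs_coord[OF W] at_x_def at_1_def lyndon_coord_lyndon_bracket W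
        rvp.linear_0[OF linear_lyndon_coord])
    then show "\<phi> = Abs_dual_1x (\<lambda>v. lyndon_coord W (fst v))"
      if "\<forall>V. lyndon V \<longrightarrow> app_dual \<phi> (at_1 (lyndon_bracket V)) = of_bool (V = W) \<and>
        app_dual \<phi> (at_x (lyndon_bracket V)) = 0" for \<phi>
      using that by (intro dual_eqI_lyndon) auto
  qed
  then show ?thesis by (simp add: app_dual_Abs_coord[OF W])
qed

text \<open>
  Both parts of the basis of \<open>L_{1;x}\<close> share one index type, with \<^const>\<open>True\<close> marking \<open>L_1\<close> and
  \<^const>\<open>False\<close> marking \<open>L_x\<close>, so that sums over the basis need not be split until the end.
\<close>

type_synonym index = "bool \<times> word"

definition basis :: "index \<Rightarrow> lie_1x" where
  "basis i = (if fst i then at_1 (lyndon_bracket (snd i)) else at_x (lyndon_bracket (snd i)))"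

definition dual_basis :: "index \<Rightarrow> dual_1x" where
  "dual_basis i = (if fst i then T_1 (snd i) else T_x (snd i))"

definition lyndon_upto :: "nat \<Rightarrow> word set" where
  "lyndon_upto N = {W. lyndon W \<and> length W \<le> N}"

definition index_upto :: "nat \<Rightarrow> index set" where
  "index_upto N = UNIV \<times> lyndon_upto N"

lemma finite_lyndon_upto [simp]: "finite (lyndon_upto N)"
  by (rule finite_subset[OF _ finite_lists_length_le[of "UNIV :: bool set" N]])
    (auto simp: lyndon_upto_def)

lemma finite_index_upto [simp]: "finite (index_upto N)"
  by (simp add: index_upto_def)

lemma index_upto_lyndon: "i \<in> index_upto N \<Longrightarrow> lyndon (snd i)"
  and index_upto_iff: "lyndon (snd i) \<Longrightarrow> i \<in> index_upto N \<longleftrightarrow> length (snd i) \<le> N"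
  by (cases i; auto simp: index_upto_def lyndon_upto_def)+

lemma dual_basis_basis:
  assumes "lyndon (snd i)" "lyndon (snd j)"
  shows "app_dual (dual_basis i) (basis j) = of_bool (i = j)"
  using assms
  by (auto simp: dual_basis_def basis_def app_dual_T_x app_dual_T_1 at_1_def at_x_def prod_eq_iff
    lyndon_coord_lyndon_bracket rvp.linear_0[OF linear_lyndon_coord])

lemma basis_grade: "lyndon (snd i) \<Longrightarrow> basis i \<in> grade_1x (length (snd i))"
  by (auto simp: basis_def grade_1x_def at_1_def at_x_def lyndon_bracket_grade lie_grade_zero)

lemma linear_eq_on_basis:
  assumes "linearQ f" "linearQ g" "\<And>i. lyndon (snd i) \<Longrightarrow> f (basis i) = g (basis i)"
  shows "f v = g v"
  by (rule linear_eq_on_lyndon[OF assms(1,2)])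
    (use assms(3)[of "(False, _)"] assms(3)[of "(True, _)"] in \<open>auto simp: basis_def\<close>)

text \<open>
  Every functional in the graded dual vanishes above some weight. Such a bound makes the expansions
  in the dual basis finite.
\<close>

definition vanishes_above :: "nat \<Rightarrow> (lie_1x \<Rightarrow> rat) \<Rightarrow> bool" where
  "vanishes_above N f \<longleftrightarrow> (\<forall>n>N. \<forall>v\<in>grade_1x n. f v = 0)"

lemma vanishes_above_mono: "vanishes_above N f \<Longrightarrow> N \<le> M \<Longrightarrow> vanishes_above M f"
  unfolding vanishes_above_def by (meson le_less_trans)

lemma ex_vanishes_above: "\<exists>N. vanishes_above N (app_dual \<phi>)"
proof -
  have "finite {n. \<exists>v\<in>grade_1x n. app_dual \<phi> v \<noteq> 0}" using app_dual[of \<phi>] by simp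
  then obtain N where "\<forall>n\<in>{n. \<exists>v\<in>grade_1x n. app_dual \<phi> v \<noteq> 0}. n \<le> N"
    using finite_nat_set_iff_bounded_le by blast
  then show ?thesis unfolding vanishes_above_def by (intro exI[of _ N]) (force simp: not_le)
qed

lemma vanishes_above_dual_basis: "i \<in> index_upto N \<Longrightarrow> vanishes_above N (app_dual (dual_basis i))"
  by (auto simp: vanishes_above_def dual_basis_def index_upto_def lyndon_upto_def app_dual_T_x app_dual_T_1
    grade_1x_def intro!: lyndon_coord_grade)

lemma functional_expansion:
  assumes f: "linearQ f" and N: "vanishes_above N f"
  shows "f v = (\<Sum>i\<in>index_upto N. f (basis i) * app_dual (dual_basis i) v)"
proof (rule linear_eq_on_basis[OF f])
  show "linearQ (\<lambda>v. \<Sum>i\<in>index_upto N. f (basis i) * app_dual (dual_basis i) v)"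
    by (rule linearQI) (simp_all add: rvp.linear_add[OF linear_app_dual]
      rvp.linear_scale[OF linear_app_dual] scaleQ_rat_def distrib_left sum.distrib
      sum_distrib_left ac_simps)
next
  fix j :: index assume j: "lyndon (snd j)"
  have "(\<Sum>i\<in>index_upto N. f (basis i) * app_dual (dual_basis i) (basis j))
      = (\<Sum>i\<in>index_upto N. if i = j then f (basis i) else 0)"
    by (rule sum.cong) (auto simp: dual_basis_basis index_upto_lyndon j)
  also have "\<dots> = f (basis j)"
    using N basis_grade[OF j] unfolding vanishes_above_def by (auto simp: index_upto_iff j not_le)
  finally show "f (basis j) = (\<Sum>i\<in>index_upto N. f (basis i) * app_dual (dual_basis i) (basis j))" ..
qed

lemma dual_expansion:
  assumes "vanishes_above N (app_dual \<phi>)"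
  shows "\<phi> = (\<Sum>i\<in>index_upto N. app_dual \<phi> (basis i) *\<^sub>Q dual_basis i)"
  unfolding app_dual_inject[symmetric]
  by (rule ext, subst functional_expansion[OF linear_app_dual assms])
    (simp add: rvp.linear_sum[OF linear_app_dual_left] rvp.linear_scale[OF linear_app_dual_left]
      scaleQ_rat_def)

section \<open>The pairing on the exterior square\<close>

lemma linear_ext_pair: "linearQ (\<lambda>\<omega>. ext_pair \<omega> u v)"
  by (rule linearQI; transfer) (simp_all add: lin_ext_add lin_ext_scale)

lemma ext_pair_list: "ext_pair (ext_of_list xs) u v = pair_list xs u v"
  by transfer simp

lemma ext_pair_wedge: "ext_pair (ext_incl \<phi> \<and>\<^sub>E ext_incl \<psi>) u v
    = app_dual \<phi> u * app_dual \<psi> v - app_dual \<phi> v * app_dual \<psi> u"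
  using ext_pair_list[of "[\<phi>, \<psi>]" u v] by (simp add: ext_of_list_Cons)

lemma linear_ext_pair_bilinear:
  assumes "\<omega> \<in> ext_power 2"
  shows "linearQ (\<lambda>u. ext_pair \<omega> u v) \<and> linearQ (ext_pair \<omega> u)"
  using assms
proof (induction rule: ext_power_2_induct)
  case (wedge \<phi> \<psi>)
  show ?case
    by (intro conjI linearQI) (simp_all add: ext_pair_wedge rvp.linear_add[OF linear_app_dual]
      rvp.linear_scale[OF linear_app_dual] scaleQ_rat_def algebra_simps)
next
  case (add a b)
  then show ?case
    by (simp add: rvp.linear_add[OF linear_ext_pair] rvp.linear_compose_add
      rvp.linear_add[OF linear_ext_pair, abs_def])
next
  case (scale c a)
  then show ?case
    by (simp add: rvp.linear_scale[OF linear_ext_pair] rvp.linear_compose_scale_right)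
qed

abbreviation dual_wedge :: "index \<Rightarrow> index \<Rightarrow> dual_1x ext" where
  "dual_wedge i j \<equiv> ext_incl (dual_basis i) \<and>\<^sub>E ext_incl (dual_basis j)"

text \<open>
  The element of the exterior square with a given alternating matrix of pairings, truncated at
  weight \<open>N\<close>. The factor \<open>1/2\<close> is due to the summation over ordered pairs.
\<close>

definition wedge_form :: "nat \<Rightarrow> (lie_1x \<Rightarrow> lie_1x \<Rightarrow> rat) \<Rightarrow> dual_1x ext" where
  "wedge_form N B = (1/2) *\<^sub>Q (\<Sum>i\<in>index_upto N. \<Sum>j\<in>index_upto N. B (basis i) (basis j) *\<^sub>Q dual_wedge i j)"

lemma scaleQ_half_double: "(1/2) *\<^sub>Q (x + x) = (x::'a::rat_vector)"
  by (simp add: scaleQ_add_right scaleQ_one flip: scaleQ_add_left)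

lemma wedge_form_add: "wedge_form N (\<lambda>u v. B u v + C u v) = wedge_form N B + wedge_form N C"
  by (simp add: wedge_form_def scaleQ_add_left sum.distrib scaleQ_add_right)

lemma wedge_form_scale: "wedge_form N (\<lambda>u v. c * B u v) = c *\<^sub>Q wedge_form N B"
  by (simp add: wedge_form_def rv.scale_sum_right scaleQ_scaleQ ac_simps)

lemma wedge_form_ext_power: "wedge_form N B \<in> ext_power 2"
  unfolding wedge_form_def by (intro ext_power_scale ext_power_sum ext_power_2_incl)

text \<open>
  For \<open>\<phi> \<and> \<psi>\<close> both factors are expanded in the dual basis and the result is averaged with
  \<open>- \<psi> \<and> \<phi>\<close>. The equation is claimed for all large truncations so that it can be added up, and so that
  two elements can be compared at a common truncation.
\<close>

lemma ext_power_2_expansion: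
  assumes "\<omega> \<in> ext_power 2"
  shows "\<exists>N. \<forall>M\<ge>N. \<omega> = wedge_form M (ext_pair \<omega>)"
  using assms
proof (induction rule: ext_power_2_induct)
  case (wedge \<phi> \<psi>)
  obtain N1 N2 where N: "vanishes_above N1 (app_dual \<phi>)" "vanishes_above N2 (app_dual \<psi>)"
    using ex_vanishes_above by metis
  have "ext_incl \<phi> \<and>\<^sub>E ext_incl \<psi> = wedge_form M (ext_pair (ext_incl \<phi> \<and>\<^sub>E ext_incl \<psi>))"
    if M: "max N1 N2 \<le> M" for M
  proof -
    let ?I = "index_upto M"
    have exp: "ext_incl \<chi> = (\<Sum>i\<in>?I. app_dual \<chi> (basis i) *\<^sub>Q ext_incl (dual_basis i))"
      if "vanishes_above M (app_dual \<chi>)" for \<chi>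
      using dual_expansion[OF that, THEN arg_cong, of ext_incl]
      by (simp add: rvp.linear_sum[OF linear_ext_incl] ext_incl_scale)
    have prod: "ext_incl \<chi> \<and>\<^sub>E ext_incl \<eta>
        = (\<Sum>i\<in>?I. \<Sum>j\<in>?I. (app_dual \<chi> (basis i) * app_dual \<eta> (basis j)) *\<^sub>Q dual_wedge i j)"
      if "vanishes_above M (app_dual \<chi>)" "vanishes_above M (app_dual \<eta>)" for \<chi> \<eta>
      by (subst exp[OF that(1)], subst exp[OF that(2)])
        (simp add: wedge_sum_left wedge_sum_right wedge_scale_left wedge_scale_right
          rv.scale_sum_right scaleQ_scaleQ, subst sum.swap, simp add: mult.commute)
    have "vanishes_above M (app_dual \<phi>)" "vanishes_above M (app_dual \<psi>)"
      using N M by (auto intro: vanishes_above_mono)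
    note * = prod[OF this] prod[OF this(2,1)]
    have "(ext_incl \<phi> \<and>\<^sub>E ext_incl \<psi>) + (ext_incl \<phi> \<and>\<^sub>E ext_incl \<psi>)
      = (ext_incl \<phi> \<and>\<^sub>E ext_incl \<psi>) - (ext_incl \<psi> \<and>\<^sub>E ext_incl \<phi>)"
      using ext_incl_anticomm[of \<phi> \<psi>] by simp
    also have "\<dots> = (\<Sum>i\<in>?I. \<Sum>j\<in>?I. ext_pair (ext_incl \<phi> \<and>\<^sub>E ext_incl \<psi>) (basis i) (basis j) *\<^sub>Q
        dual_wedge i j)"
      unfolding ext_pair_wedge
      unfolding * sum_subtractf[symmetric] rv.scale_left_diff_distrib[symmetric]
      by (simp add: mult.commute)
    finally show ?thesis
      using scaleQ_half_double[of "ext_incl \<phi> \<and>\<^sub>E ext_incl \<psi>"] by (simp add: wedge_form_def)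
  qed
  then show ?case by blast
next
  case (add a b)
  then obtain N1 N2 where "\<forall>M\<ge>N1. a = wedge_form M (ext_pair a)"
    "\<forall>M\<ge>N2. b = wedge_form M (ext_pair b)" by blast
  moreover have "ext_pair (a + b) = (\<lambda>u v. ext_pair a u v + ext_pair b u v)"
    by (simp add: fun_eq_iff rvp.linear_add[OF linear_ext_pair])
  ultimately show ?case
    by (intro exI[of _ "max N1 N2"]) (simp add: wedge_form_add)
next
  case (scale c a)
  then obtain N where "\<forall>M\<ge>N. a = wedge_form M (ext_pair a)" by blast
  moreover have "ext_pair (c *\<^sub>Q a) = (\<lambda>u v. c * ext_pair a u v)"
    by (simp add: fun_eq_iff rvp.linear_scale[OF linear_ext_pair] scaleQ_rat_def)
  ultimately show ?case
    by (intro exI[of _ N]) (simp add: wedge_form_scale)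
qed

section \<open>The cobracket\<close>

lemma is_cobracket_unique:
  assumes "is_cobracket \<phi> \<omega>" "is_cobracket \<phi> \<omega>'"
  shows "\<omega> = \<omega>'"
proof -
  have eq: "ext_pair \<omega> = ext_pair \<omega>'" using assms by (auto simp: is_cobracket_def fun_eq_iff)
  obtain N N' where "\<forall>M\<ge>N. \<omega> = wedge_form M (ext_pair \<omega>)"
    "\<forall>M\<ge>N'. \<omega>' = wedge_form M (ext_pair \<omega>')"
    using assms ext_power_2_expansion unfolding is_cobracket_def by metis
  then show ?thesis using eq by (metis max.cobounded1 max.cobounded2)
qed

lemma sum_sum_delta:
  fixes c :: "'i \<Rightarrow> 'i \<Rightarrow> rat"
  assumes "finite I"
  shows "(\<Sum>i\<in>I. \<Sum>j\<in>I. c i j * (of_bool (i = k) * of_bool (j = l)))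
    = (if k \<in> I \<and> l \<in> I then c k l else 0)"
proof -
  have "(\<Sum>i\<in>I. \<Sum>j\<in>I. c i j * (of_bool (i = k) * of_bool (j = l)))
      = (\<Sum>i\<in>I. if i = k then (\<Sum>j\<in>I. if j = l then c i j else 0) else 0)"
    by (intro sum.cong) (auto intro!: sum.cong)
  then show ?thesis using assms by simp
qed

text \<open>
  By bilinearity only pairs of basis vectors matter. If one of them lies beyond the truncation, so
  does the weight of their bracket, and \<open>\<phi>\<close> vanishes on it.
\<close>

lemma is_cobracket_wedge_form:
  assumes N: "vanishes_above N (app_dual \<phi>)"
  shows "is_cobracket \<phi> (wedge_form N (\<lambda>u v. app_dual \<phi> (bracket_1x u v)))"
proof -
  let ?B = "\<lambda>u v. app_dual \<phi> (bracket_1x u v)" and ?I = "index_upto N"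
  let ?\<omega> = "wedge_form N ?B"
  note pair_lin = linear_ext_pair_bilinear[OF wedge_form_ext_power]
  have B_lin: "linearQ (\<lambda>u. ?B u v)" "linearQ (?B u)" for u v
    using Vector_Spaces.linear_compose[OF linear_bracket_1x(1) linear_app_dual]
      Vector_Spaces.linear_compose[OF linear_bracket_1x(2) linear_app_dual]
    by (auto simp: comp_def)
  have B_anti: "?B v u = - ?B u v" for u v
    using bracket_1x_antisym[of v u] rvp.linear_neg[OF linear_app_dual] by metis
  have basis: "ext_pair ?\<omega> (basis k) (basis l) = ?B (basis k) (basis l)"
    if k: "lyndon (snd k)" and l: "lyndon (snd l)" for k l
  proof -
    have "(\<Sum>i\<in>?I. \<Sum>j\<in>?I. ?B (basis i) (basis j) *\<^sub>Q ext_pair (dual_wedge i j) (basis k) (basis l))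
      = (\<Sum>i\<in>?I. \<Sum>j\<in>?I. ?B (basis i) (basis j) * (of_bool (i = k) * of_bool (j = l)))
      - (\<Sum>i\<in>?I. \<Sum>j\<in>?I. ?B (basis i) (basis j) * (of_bool (i = l) * of_bool (j = k)))"
      unfolding sum_subtractf[symmetric]
      by (intro sum.cong refl)
        (simp add: ext_pair_wedge dual_basis_basis k l index_upto_lyndon scaleQ_rat_def right_diff_distrib)
    also have "\<dots> = (if k \<in> ?I \<and> l \<in> ?I then 2 * ?B (basis k) (basis l) else 0)"
      using B_anti[of "basis k" "basis l"] by (simp add: sum_sum_delta)
    also have "\<dots> = 2 * ?B (basis k) (basis l)"
    proof (cases "k \<in> ?I \<and> l \<in> ?I")
      case False
      then have "N < length (snd k) + length (snd l)"
        using k l by (auto simp: index_upto_iff)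
      then have "?B (basis k) (basis l) = 0"
        using N bracket_1x_grade[OF basis_grade[OF k] basis_grade[OF l]]
        unfolding vanishes_above_def by blast
      then show ?thesis by simp
    qed simp
    finally show ?thesis
      by (simp add: wedge_form_def rvp.linear_sum[OF linear_ext_pair]
        rvp.linear_scale[OF linear_ext_pair] scaleQ_rat_def)
  qed
  have 1: "ext_pair ?\<omega> u (basis l) = ?B u (basis l)" if "lyndon (snd l)" for u l
    by (rule linear_eq_on_basis[OF pair_lin[THEN conjunct1] B_lin(1)]) (use basis that in blast)
  have "ext_pair ?\<omega> u v = ?B u v" for u v
    by (rule linear_eq_on_basis[OF pair_lin[THEN conjunct2] B_lin(2)]) (use 1 in blast)
  then show ?thesis by (simp add: is_cobracket_def wedge_form_ext_power)
qed

lemma ex1_is_cobracket: "\<exists>!\<omega>. is_cobracket \<phi> \<omega>"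
  using ex_vanishes_above is_cobracket_wedge_form is_cobracket_unique by metis

lemma is_cobracket_d_cy: "is_cobracket \<phi> (d_cy \<phi>)"
  unfolding d_cy_def using theI'[OF ex1_is_cobracket] .

lemma d_cy_eqI: "is_cobracket \<phi> \<omega> \<Longrightarrow> d_cy \<phi> = \<omega>"
  using is_cobracket_unique is_cobracket_d_cy by blast

lemma d_cy_ext_power: "d_cy \<phi> \<in> ext_power 2"
  using is_cobracket_d_cy by (auto simp: is_cobracket_def)

lemma d_cy_expansion:
  assumes "vanishes_above N (app_dual \<phi>)"
  shows "d_cy \<phi> = wedge_form N (\<lambda>u v. app_dual \<phi> (bracket_1x u v))"
  by (intro d_cy_eqI is_cobracket_wedge_form assms)

lemma linear_d_cy: "linearQ d_cy"
proof (rule linearQI)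
  show "d_cy (\<phi> + \<psi>) = d_cy \<phi> + d_cy \<psi>" for \<phi> \<psi>
    using is_cobracket_d_cy[of \<phi>] is_cobracket_d_cy[of \<psi>]
    by (intro d_cy_eqI) (auto simp: is_cobracket_def ext_power_add plus_dual_1x.rep_eq
      rvp.linear_add[OF linear_ext_pair])
  show "d_cy (c *\<^sub>Q \<phi>) = c *\<^sub>Q d_cy \<phi>" for c \<phi>
    using is_cobracket_d_cy[of \<phi>]
    by (intro d_cy_eqI) (auto simp: is_cobracket_def ext_power_scale scaleQ_dual_1x.rep_eq
      rvp.linear_scale[OF linear_ext_pair])
qed

section \<open>The square of the differential\<close>

lemma linear_app_bracket: "linearQ (\<lambda>u. app_dual \<phi> (bracket_1x u v))"
  using Vector_Spaces.linear_compose[OF linear_bracket_1x(1) linear_app_dual] by (simp add: comp_def)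

text \<open>
  Bracketing with a homogeneous element never lowers the weight.
\<close>

lemma vanishes_above_app_bracket:
  assumes "vanishes_above N (app_dual \<phi>)" "v \<in> grade_1x m"
  shows "vanishes_above N (\<lambda>u. app_dual \<phi> (bracket_1x u v))"
  unfolding vanishes_above_def
proof (intro allI impI ballI)
  fix n u assume "N < n" "u \<in> grade_1x n"
  then have "bracket_1x u v \<in> grade_1x (n + m)" "N < n + m"
    using bracket_1x_grade assms(2) by auto
  then show "app_dual \<phi> (bracket_1x u v) = 0" using assms(1) unfolding vanishes_above_def by blast
qed

lemma sum_rotate:
  "(\<Sum>k\<in>A. \<Sum>l\<in>B. \<Sum>j\<in>C. h k l j) = (\<Sum>j\<in>C. \<Sum>k\<in>A. \<Sum>l\<in>B. h k l j)"
proof -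
  have "(\<Sum>k\<in>A. \<Sum>l\<in>B. \<Sum>j\<in>C. h k l j) = (\<Sum>k\<in>A. \<Sum>j\<in>C. \<Sum>l\<in>B. h k l j)"
    by (intro sum.cong refl sum.swap)
  also have "\<dots> = (\<Sum>j\<in>C. \<Sum>k\<in>A. \<Sum>l\<in>B. h k l j)" by (rule sum.swap)
  finally show ?thesis .
qed

text \<open>
  With \<open>c\<^sub>i\<^sub>j = \<phi>({b\<^sub>i, b\<^sub>j})\<close>, the Leibniz rule and the antisymmetry of \<open>c\<close> give
  \<open>d (d_cy \<phi>) = \<Sum>\<^sub>i\<^sub>j c\<^sub>i\<^sub>j d_cy(e\<^sub>i) \<and> e\<^sub>j\<close>. Expanding \<open>d_cy(e\<^sub>i)\<close> and summing over \<open>i\<close> reassembles the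
  functional \<open>v \<mapsto> \<phi>({v, b\<^sub>j})\<close> at \<open>v = {b\<^sub>k, b\<^sub>l}\<close>, so that double brackets appear, weighted by
  triple wedges that are invariant under cyclic permutation.
\<close>

lemma d_cy_square_zero:
  assumes d: "leibniz_extension d_cy d"
  shows "d (d_cy \<phi>) = 0"
proof -
  obtain N where N: "vanishes_above N (app_dual \<phi>)" using ex_vanishes_above by blast
  let ?I = "index_upto N"
  define c where "c i j = app_dual \<phi> (bracket_1x (basis i) (basis j))" for i j
  define e where "e i = ext_incl (dual_basis i)" for i
  define g where "g k l j = app_dual \<phi> (bracket_1x (bracket_1x (basis k) (basis l)) (basis j))" for k l j
  define E where "E k l j = (e k \<and>\<^sub>E e l) \<and>\<^sub>E e j" for k l j
  note lin = leibniz_extensionD(1)[OF d]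
  have anti: "c j i = - c i j" for i j
    using bracket_1x_antisym[of "basis j" "basis i"] rvp.linear_neg[OF linear_app_dual]
    by (metis c_def)
  have d_wedge: "d (e i \<and>\<^sub>E e j) = (d_cy (dual_basis i) \<and>\<^sub>E e j) - (d_cy (dual_basis j) \<and>\<^sub>E e i)" for i j
    using leibniz_extensionD(3)[OF d ext_power_incl, of "dual_basis i" "e j"]
      ext_power_2_commute[OF d_cy_ext_power, of "dual_basis j" "dual_basis i"]
    by (simp add: e_def leibniz_extensionD(2)[OF d])
  have swap: "(\<Sum>i\<in>?I. \<Sum>j\<in>?I. c i j *\<^sub>Q (d_cy (dual_basis j) \<and>\<^sub>E e i))
      = - (\<Sum>i\<in>?I. \<Sum>j\<in>?I. c i j *\<^sub>Q (d_cy (dual_basis i) \<and>\<^sub>E e j))"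
  proof -
    have "(\<Sum>i\<in>?I. \<Sum>j\<in>?I. c i j *\<^sub>Q (d_cy (dual_basis j) \<and>\<^sub>E e i))
        = (\<Sum>i\<in>?I. \<Sum>j\<in>?I. c j i *\<^sub>Q (d_cy (dual_basis i) \<and>\<^sub>E e j))"
      by (rule sum.swap)
    also have "\<dots> = (\<Sum>i\<in>?I. \<Sum>j\<in>?I. - (c i j *\<^sub>Q (d_cy (dual_basis i) \<and>\<^sub>E e j)))"
      by (intro sum.cong refl) (metis anti rv.scale_minus_left)
    finally show ?thesis by (simp add: sum_negf)
  qed
  have "d_cy \<phi> = (1/2) *\<^sub>Q (\<Sum>i\<in>?I. \<Sum>j\<in>?I. c i j *\<^sub>Q (e i \<and>\<^sub>E e j))"
    by (simp add: d_cy_expansion[OF N] wedge_form_def c_def e_def)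
  then have "d (d_cy \<phi>) = (1/2) *\<^sub>Q ((\<Sum>i\<in>?I. \<Sum>j\<in>?I. c i j *\<^sub>Q (d_cy (dual_basis i) \<and>\<^sub>E e j))
      - (\<Sum>i\<in>?I. \<Sum>j\<in>?I. c i j *\<^sub>Q (d_cy (dual_basis j) \<and>\<^sub>E e i)))"
    by (simp add: rvp.linear_sum[OF lin] rvp.linear_scale[OF lin] d_wedge
      rv.scale_right_diff_distrib sum_subtractf)
  then have "d (d_cy \<phi>) = (\<Sum>i\<in>?I. \<Sum>j\<in>?I. c i j *\<^sub>Q (d_cy (dual_basis i) \<and>\<^sub>E e j))"
    by (simp add: swap scaleQ_half_double)
  also have "\<dots> = (\<Sum>i\<in>?I. \<Sum>j\<in>?I. \<Sum>k\<in>?I. \<Sum>l\<in>?I.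
      ((1/2) * (c i j * app_dual (dual_basis i) (bracket_1x (basis k) (basis l)))) *\<^sub>Q E k l j)"
    by (intro sum.cong refl, subst d_cy_expansion[OF vanishes_above_dual_basis])
      (simp_all add: wedge_form_def wedge_scale_left wedge_sum_left rv.scale_sum_right scaleQ_scaleQ
        E_def e_def ac_simps)
  also have "\<dots> = (\<Sum>k\<in>?I. \<Sum>l\<in>?I. \<Sum>j\<in>?I. \<Sum>i\<in>?I.
      ((1/2) * (c i j * app_dual (dual_basis i) (bracket_1x (basis k) (basis l)))) *\<^sub>Q E k l j)"
    (is "(\<Sum>i\<in>_. \<Sum>j\<in>_. \<Sum>k\<in>_. \<Sum>l\<in>_. ?t i j k l) = _")
  proof -
    have "(\<Sum>i\<in>?I. \<Sum>j\<in>?I. \<Sum>k\<in>?I. \<Sum>l\<in>?I. ?t i j k l)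
        = (\<Sum>j\<in>?I. \<Sum>i\<in>?I. \<Sum>k\<in>?I. \<Sum>l\<in>?I. ?t i j k l)"
      by (rule sum.swap)
    also have "\<dots> = (\<Sum>j\<in>?I. \<Sum>k\<in>?I. \<Sum>l\<in>?I. \<Sum>i\<in>?I. ?t i j k l)"
      by (rule sum.cong[OF refl], rule sum_rotate[symmetric])
    also have "\<dots> = (\<Sum>k\<in>?I. \<Sum>l\<in>?I. \<Sum>j\<in>?I. \<Sum>i\<in>?I. ?t i j k l)"
      by (rule sum_rotate[symmetric])
    finally show ?thesis .
  qed
  also have "\<dots> = (\<Sum>k\<in>?I. \<Sum>l\<in>?I. \<Sum>j\<in>?I. ((1/2) * g k l j) *\<^sub>Q E k l j)"
  proof (intro sum.cong refl)
    fix k l j assume j: "j \<in> ?I"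
    have "g k l j = (\<Sum>i\<in>?I. c i j * app_dual (dual_basis i) (bracket_1x (basis k) (basis l)))"
      unfolding g_def c_def
      by (rule functional_expansion[OF linear_app_bracket
            vanishes_above_app_bracket[OF N basis_grade[OF index_upto_lyndon[OF j]]]])
    then show "(\<Sum>i\<in>?I. ((1/2) * (c i j * app_dual (dual_basis i) (bracket_1x (basis k) (basis l)))) *\<^sub>Q E k l j)
        = ((1/2) * g k l j) *\<^sub>Q E k l j"
      by (simp only: sum_distrib_left rv.scale_sum_left)
  qed
  finally have ddphi: "d (d_cy \<phi>) = (1/2) *\<^sub>Q (\<Sum>k\<in>?I. \<Sum>l\<in>?I. \<Sum>j\<in>?I. g k l j *\<^sub>Q E k l j)"
    (is "_ = _ *\<^sub>Q ?S") by (simp add: rv.scale_sum_right scaleQ_scaleQ)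
  have E_cyc: "E l j k = E k l j" for k l j
    using ext_power_2_commute[OF ext_power_2_incl, of "dual_basis l" "dual_basis j" "dual_basis k"]
    by (simp add: E_def e_def wedge_assoc)
  have S1: "(\<Sum>k\<in>?I. \<Sum>l\<in>?I. \<Sum>j\<in>?I. g l j k *\<^sub>Q E k l j) = ?S"
  proof -
    have "(\<Sum>k\<in>?I. \<Sum>l\<in>?I. \<Sum>j\<in>?I. g l j k *\<^sub>Q E k l j)
        = (\<Sum>k\<in>?I. \<Sum>l\<in>?I. \<Sum>j\<in>?I. g k l j *\<^sub>Q E j k l)"
      by (rule sum_rotate[symmetric])
    also have "\<dots> = ?S" by (intro sum.cong refl) (metis E_cyc)
    finally show ?thesis .
  qed
  have S2: "(\<Sum>k\<in>?I. \<Sum>l\<in>?I. \<Sum>j\<in>?I. g j k l *\<^sub>Q E k l j) = ?S"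
  proof -
    have "(\<Sum>k\<in>?I. \<Sum>l\<in>?I. \<Sum>j\<in>?I. g j k l *\<^sub>Q E k l j)
        = (\<Sum>k\<in>?I. \<Sum>l\<in>?I. \<Sum>j\<in>?I. g k l j *\<^sub>Q E l j k)"
      by (rule sum_rotate)
    also have "\<dots> = ?S" by (intro sum.cong refl) (metis E_cyc)
    finally show ?thesis .
  qed
  have jac: "g k l j + g l j k + g j k l = 0" for k l j
    using bracket_1x_jacobi[of "basis k" "basis l" "basis j"]
    by (simp add: g_def rvp.linear_0[OF linear_app_dual] flip: rvp.linear_add[OF linear_app_dual])
  have "(3::rat) *\<^sub>Q ?S = ?S + ?S + ?S"
  proof -
    have "(3::rat) *\<^sub>Q ?S = (1 + 1 + 1) *\<^sub>Q ?S" by simp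
    then show ?thesis by (simp only: scaleQ_add_left scaleQ_one)
  qed
  also have "\<dots> = (\<Sum>k\<in>?I. \<Sum>l\<in>?I. \<Sum>j\<in>?I. (g k l j + g l j k + g j k l) *\<^sub>Q E k l j)"
    by (simp only: scaleQ_add_left sum.distrib S1 S2)
  also have "\<dots> = 0" by (simp add: jac)
  finally show ?thesis by (simp add: ddphi rv.scale_eq_0_iff)
qed

section \<open>Structure coefficients\<close>

text \<open>
  The structure coefficients are defined as coordinates. A coordinate is the unique linear functional
  with the Kronecker values on the basis, so they are values of \<open>T_x\<close> and \<open>T_1\<close>.
\<close>

lemma representation_eq_functional:
  assumes B: "rv.independent B" and v: "v \<in> rv.span B" and f: "linearQ f"
    and delta: "\<And>b. b \<in> B \<Longrightarrow> f b = of_bool (b = b0)" and "b0 \<in> B"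
  shows "rv.representation B v b0 = f v"
proof -
  let ?r = "rv.representation B v"
  have fin: "finite {b. ?r b \<noteq> 0}" by (rule rv.finite_representation)
  have "f v = f (\<Sum>b | ?r b \<noteq> 0. ?r b *\<^sub>Q b)"
    by (simp add: rv.sum_nonzero_representation_eq[OF B v])
  also have "\<dots> = (\<Sum>b | ?r b \<noteq> 0. ?r b * f b)"
    by (simp add: rvp.linear_sum[OF f] rvp.linear_scale[OF f] scaleQ_rat_def)
  also have "\<dots> = (\<Sum>b | ?r b \<noteq> 0. if b = b0 then ?r b else 0)"
    using rv.representation_ne_zero[of B v] by (intro sum.cong) (auto simp: delta)
  also have "\<dots> = ?r b0" using fin by simp
  finally show ?thesis ..
qed

lemma inj_at_1: "inj at_1" and inj_at_x: "inj at_x"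
  by (auto simp: inj_def at_1_def at_x_def)

lemma lyndon_image_span:
  assumes "linearQ h"
  shows "h f \<in> rv.span {h (lyndon_bracket W) | W. lyndon W}"
  by (rule span_linear_image[OF assms, of "{lyndon_bracket W | W. lyndon W}"])
    (auto intro: rv.span_base simp: lyndon_brackets_span)

lemma lyndon_image_independent:
  assumes "linearQ h" "inj h"
  shows "rv.independent {h (lyndon_bracket W) | W. lyndon W}"
proof -
  have "{h (lyndon_bracket W) | W. lyndon W} = h ` {lyndon_bracket W | W. lyndon W}" by auto
  then show ?thesis
    using rvp.linear_independent_injective_image[OF assms(1) lyndon_brackets_independent]
      assms(2) by (simp add: inj_on_subset)
qed

lemma representation_at_x:
  assumes "lyndon W"
  shows "rv.representation {at_x (lyndon_bracket V) | V. lyndon V} (at_x f) (at_x (lyndon_bracket W))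
    = app_dual (T_x W) (at_x f)"
proof (rule representation_eq_functional[OF lyndon_image_independent lyndon_image_span linear_app_dual])
  fix b assume "b \<in> {at_x (lyndon_bracket V) |V. lyndon V}"
  then obtain V where V: "b = at_x (lyndon_bracket V)" "lyndon V" by auto
  have "b = at_x (lyndon_bracket W) \<longleftrightarrow> V = W"
    using V assms inj_on_lyndon_bracket inj_at_x by (auto simp: inj_on_def)
  then show "app_dual (T_x W) b = of_bool (b = at_x (lyndon_bracket W))"
    using V assms by (simp add: app_dual_T_x lyndon_coord_lyndon_bracket) (simp add: at_x_def lyndon_coord_lyndon_bracket)
qed (use assms linear_at_x inj_at_x in auto)

lemma representation_at_1:
  assumes "lyndon W"
  shows "rv.representation {at_1 (lyndon_bracket V) | V. lyndon V} (at_1 f) (at_1 (lyndon_bracket W))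
    = app_dual (T_1 W) (at_1 f)"
proof (rule representation_eq_functional[OF lyndon_image_independent lyndon_image_span linear_app_dual])
  fix b assume "b \<in> {at_1 (lyndon_bracket V) |V. lyndon V}"
  then obtain V where V: "b = at_1 (lyndon_bracket V)" "lyndon V" by auto
  have "b = at_1 (lyndon_bracket W) \<longleftrightarrow> V = W"
    using V assms inj_on_lyndon_bracket inj_at_1 by (auto simp: inj_on_def)
  then show "app_dual (T_1 W) b = of_bool (b = at_1 (lyndon_bracket W))"
    using V assms by (simp add: app_dual_T_1 lyndon_coord_lyndon_bracket) (simp add: at_1_def lyndon_coord_lyndon_bracket)
qed (use assms linear_at_1 inj_at_1 in auto)

lemma bracket_1x_x_x: "bracket_1x (at_x f) (at_x g) = at_x (lie_bracket f g)"
  and bracket_1x_x_1: "bracket_1x (at_x f) (at_1 g) = at_x (- der g f)"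
  and bracket_1x_1_1: "bracket_1x (at_1 f) (at_1 g) = at_1 (ihara f g)"
  by (simp_all add: at_x_def at_1_def ihara_def)

lemma alpha_eq: "lyndon W \<Longrightarrow> alpha W U V = app_dual (T_x W) (bracket_1x (basis (False, U)) (basis (False, V)))"
  and beta_eq: "lyndon W \<Longrightarrow> beta W U V = app_dual (T_x W) (bracket_1x (basis (False, U)) (basis (True, V)))"
  and gamma_eq: "lyndon W \<Longrightarrow> gamma W U V = app_dual (T_1 W) (bracket_1x (basis (True, U)) (basis (True, V)))"
  by (simp_all add: alpha_def beta_def gamma_def basis_def bracket_1x_x_x bracket_1x_x_1
    bracket_1x_1_1 representation_at_x representation_at_1)

text \<open>
  Weights add up under the bracket; this is what makes the sums over Lyndon words finite.
\<close>

lemma T_bracket_nonzero_length: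
  assumes W: "lyndon W" and ij: "lyndon (snd i)" "lyndon (snd j)"
    and nz: "app_dual (dual_basis (b, W)) (bracket_1x (basis i) (basis j)) \<noteq> 0"
  shows "length (snd i) \<le> length W" "length (snd j) \<le> length W"
proof -
  have "vanishes_above (length W) (app_dual (dual_basis (b, W)))"
    by (rule vanishes_above_dual_basis) (simp add: index_upto_iff W)
  then have "length (snd i) + length (snd j) \<le> length W"
    using bracket_1x_grade[OF basis_grade[OF ij(1)] basis_grade[OF ij(2)]] nz
    unfolding vanishes_above_def by (meson not_le)
  then show "length (snd i) \<le> length W" "length (snd j) \<le> length W" by auto
qed

lemma sum_sum_symmetric:
  fixes F :: "'i::linorder \<Rightarrow> 'i \<Rightarrow> 'a::ab_group_add"
  assumes I: "finite I" and diag: "\<And>i. F i i = 0" and sym: "\<And>i j. F i j = F j i"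
  shows "(\<Sum>i\<in>I. \<Sum>j\<in>I. F i j)
    = (\<Sum>(i, j) | i \<in> I \<and> j \<in> I \<and> i < j. F i j) + (\<Sum>(i, j) | i \<in> I \<and> j \<in> I \<and> i < j. F i j)"
proof -
  let ?L = "{(i, j). i \<in> I \<and> j \<in> I \<and> i < j}" and ?G = "{(i, j). i \<in> I \<and> j \<in> I \<and> j < i}"
  let ?D = "(\<lambda>i. (i, i)) ` I"
  have fin: "finite ?L" "finite ?G"
    by (rule finite_subset[of _ "I \<times> I"]; use I in auto)+
  have "I \<times> I = (?L \<union> ?G) \<union> ?D" by (auto simp: not_less_iff_gr_or_eq)
  then have "(\<Sum>i\<in>I. \<Sum>j\<in>I. F i j) = (\<Sum>(i, j)\<in>(?L \<union> ?G) \<union> ?D. F i j)"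
    by (simp add: sum.cartesian_product)
  also have "\<dots> = (\<Sum>(i, j)\<in>?L \<union> ?G. F i j)"
    using fin I by (intro sum.mono_neutral_right) (auto simp: diag)
  also have "\<dots> = (\<Sum>(i, j)\<in>?L. F i j) + (\<Sum>(i, j)\<in>?G. F i j)"
    using fin by (intro sum.union_disjoint) auto
  also have "(\<Sum>(i, j)\<in>?G. F i j) = (\<Sum>(i, j)\<in>?L. F i j)"
    by (rule sum.reindex_bij_witness[of _ prod.swap prod.swap]) (auto simp: sym)
  finally show ?thesis by simp
qed

lemma sum_index_upto: "(\<Sum>i\<in>index_upto N. f i)
    = (\<Sum>U\<in>lyndon_upto N. f (False, U)) + (\<Sum>U\<in>lyndon_upto N. f (True, U))"
proof -
  have "(\<Sum>i\<in>index_upto N. f i) = (\<Sum>b\<in>UNIV. \<Sum>U\<in>lyndon_upto N. f (b, U))"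
    by (simp add: index_upto_def sum.cartesian_product)
  then show ?thesis by (simp add: UNIV_bool)
qed

lemma sum_restrict_support:
  assumes "finite S" "S \<subseteq> A" "\<And>i j. (i, j) \<in> A \<Longrightarrow> c i j \<noteq> 0 \<Longrightarrow> (i, j) \<in> S"
  shows "finite {(i, j). (i, j) \<in> A \<and> c i j \<noteq> (0::rat)}"
    "(\<Sum>(i, j)\<in>S. c i j *\<^sub>Q F i j) = (\<Sum>(i, j) | (i, j) \<in> A \<and> c i j \<noteq> 0. c i j *\<^sub>Q F i j)"
proof -
  have sub: "{(i, j). (i, j) \<in> A \<and> c i j \<noteq> 0} \<subseteq> S" using assms by auto
  then show "finite {(i, j). (i, j) \<in> A \<and> c i j \<noteq> 0}" using assms finite_subset by blast
  show "(\<Sum>(i, j)\<in>S. c i j *\<^sub>Q F i j) = (\<Sum>(i, j) | (i, j) \<in> A \<and> c i j \<noteq> 0. c i j *\<^sub>Q F i j)"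
    using assms(1,2) sub by (intro sum.mono_neutral_right) auto
qed

text \<open>
  Unordered pairs of distinct indices occur twice in the expansion, which absorbs the factor \<open>1/2\<close>.
  Pairs with equal marks are listed in increasing order of words, mixed pairs with the \<open>L_x\<close> index
  first.
\<close>

lemma d_cy_dual_basis:
  fixes b W
  defines "c \<equiv> \<lambda>i j. app_dual (dual_basis (b, W)) (bracket_1x (basis i) (basis j))"
  assumes W: "lyndon W"
  shows "d_cy (dual_basis (b, W)) =
      (\<Sum>(U, V) | U \<in> lyndon_upto (length W) \<and> V \<in> lyndon_upto (length W) \<and> U < V.
        c (False, U) (False, V) *\<^sub>Q dual_wedge (False, U) (False, V))
    + (\<Sum>(U, V) | U \<in> lyndon_upto (length W) \<and> V \<in> lyndon_upto (length W) \<and> U < V.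
        c (True, U) (True, V) *\<^sub>Q dual_wedge (True, U) (True, V))
    + (\<Sum>(U, V)\<in>lyndon_upto (length W) \<times> lyndon_upto (length W).
        c (False, U) (True, V) *\<^sub>Q dual_wedge (False, U) (True, V))" (is "_ = ?A + ?B + ?C")
proof -
  let ?P = "lyndon_upto (length W)"
  define F where "F i j = c i j *\<^sub>Q dual_wedge i j" for i j
  have sym: "F i j = F j i" for i j
  proof -
    have "c i j = - c j i"
      using bracket_1x_antisym[of "basis i" "basis j"] rvp.linear_neg[OF linear_app_dual]
      by (metis c_def)
    then show ?thesis using ext_incl_anticomm[of "dual_basis i" "dual_basis j"] by (simp add: F_def)
  qed
  have diag: "F i i = 0" for i by (simp add: F_def)
  have same: "(\<Sum>U\<in>?P. \<Sum>V\<in>?P. F (s, U) (s, V))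
    = (\<Sum>(U, V) | U \<in> ?P \<and> V \<in> ?P \<and> U < V. F (s, U) (s, V))
    + (\<Sum>(U, V) | U \<in> ?P \<and> V \<in> ?P \<and> U < V. F (s, U) (s, V))" for s
    by (rule sum_sum_symmetric[OF finite_lyndon_upto diag sym])
  have mixed: "(\<Sum>U\<in>?P. \<Sum>V\<in>?P. F (True, U) (False, V)) = (\<Sum>U\<in>?P. \<Sum>V\<in>?P. F (False, U) (True, V))"
    by (subst sum.swap) (intro sum.cong refl sym)
  have "d_cy (dual_basis (b, W)) = (1/2) *\<^sub>Q (\<Sum>i\<in>index_upto (length W). \<Sum>j\<in>index_upto (length W). F i j)"
    unfolding F_def c_def
    by (subst d_cy_expansion[OF vanishes_above_dual_basis, of _ "length W"])
      (simp_all add: index_upto_iff W wedge_form_def)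
  also have "(\<Sum>i\<in>index_upto (length W). \<Sum>j\<in>index_upto (length W). F i j) = (?A + ?B + ?C) + (?A + ?B + ?C)"
    by (simp add: sum_index_upto sum.distrib same mixed F_def[symmetric] flip: sum.cartesian_product)
  also have "(1/2) *\<^sub>Q \<dots> = ?A + ?B + ?C" by (rule scaleQ_half_double)
  finally show ?thesis .
qed


lemma d_cy_T_x:
  assumes W: "lyndon W"
  shows "finite {(U, V). lyndon U \<and> lyndon V \<and> U < V \<and> alpha W U V \<noteq> 0}"
    and "finite {(U, V). lyndon U \<and> lyndon V \<and> beta W U V \<noteq> 0}"
    and "d_cy (T_x W) =
          (\<Sum>(U, V) | lyndon U \<and> lyndon V \<and> U < V \<and> alpha W U V \<noteq> 0.
            alpha W U V *\<^sub>Q (ext_incl (T_x U) \<and>\<^sub>E ext_incl (T_x V)))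
        + (\<Sum>(U, V) | lyndon U \<and> lyndon V \<and> beta W U V \<noteq> 0.
            beta W U V *\<^sub>Q (ext_incl (T_x U) \<and>\<^sub>E ext_incl (T_1 V)))"
proof -
  let ?P = "lyndon_upto (length W)"
  let ?Lt = "{(U, V). U \<in> ?P \<and> V \<in> ?P \<and> U < V}"
  have fin: "finite ?Lt" by (rule finite_subset[of _ "?P \<times> ?P"]) auto
  have supp: "U \<in> ?P \<and> V \<in> ?P" if "lyndon U" "lyndon V"
    "app_dual (T_x W) (bracket_1x (basis (r, U)) (basis (s, V))) \<noteq> 0" for U V r s
    using T_bracket_nonzero_length[OF W, of "(r, U)" "(s, V)" False] that
    by (simp add: dual_basis_def lyndon_upto_def)
  have zero: "app_dual (T_x W) (bracket_1x (basis (True, U)) (basis (True, V))) = 0" for U V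
    by (simp add: basis_def bracket_1x_1_1 app_dual_T_x[OF W])
      (simp add: at_1_def rvp.linear_0[OF linear_lyndon_coord])
  have a: "(U, V) \<in> ?Lt"
    if "(U, V) \<in> {(U, V). lyndon U \<and> lyndon V \<and> U < V}" "alpha W U V \<noteq> 0" for U V
    using supp[of U V] that by (simp add: alpha_eq[OF W])
  have b: "(U, V) \<in> ?P \<times> ?P"
    if "(U, V) \<in> {(U, V). lyndon U \<and> lyndon V}" "beta W U V \<noteq> 0" for U V
    using supp[of U V] that by (simp add: beta_eq[OF W])
  have sub: "?Lt \<subseteq> {(U, V). lyndon U \<and> lyndon V \<and> U < V}"
    "?P \<times> ?P \<subseteq> {(U, V). lyndon U \<and> lyndon V}"
    by (auto simp: lyndon_upto_def)
  note alpha = sum_restrict_support[where c = "alpha W", OF fin sub(1) a]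
  note beta = sum_restrict_support[where c = "beta W", OF finite_cartesian_product[OF finite_lyndon_upto finite_lyndon_upto] sub(2) b]
  show "finite {(U, V). lyndon U \<and> lyndon V \<and> U < V \<and> alpha W U V \<noteq> 0}"
    using alpha(1) by simp
  show "finite {(U, V). lyndon U \<and> lyndon V \<and> beta W U V \<noteq> 0}"
    using beta(1) by simp
  have "d_cy (T_x W)
    = (\<Sum>(U, V)\<in>?Lt. alpha W U V *\<^sub>Q (ext_incl (T_x U) \<and>\<^sub>E ext_incl (T_x V)))
    + (\<Sum>(U, V)\<in>?P \<times> ?P. beta W U V *\<^sub>Q (ext_incl (T_x U) \<and>\<^sub>E ext_incl (T_1 V)))"
    using d_cy_dual_basis[OF W, of False] by (simp add: dual_basis_def zero alpha_eq[OF W] beta_eq[OF W])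
  then show "d_cy (T_x W) =
          (\<Sum>(U, V) | lyndon U \<and> lyndon V \<and> U < V \<and> alpha W U V \<noteq> 0.
            alpha W U V *\<^sub>Q (ext_incl (T_x U) \<and>\<^sub>E ext_incl (T_x V)))
        + (\<Sum>(U, V) | lyndon U \<and> lyndon V \<and> beta W U V \<noteq> 0.
            beta W U V *\<^sub>Q (ext_incl (T_x U) \<and>\<^sub>E ext_incl (T_1 V)))"
    using alpha(2)[of "\<lambda>U V. ext_incl (T_x U) \<and>\<^sub>E ext_incl (T_x V)"]
      beta(2)[of "\<lambda>U V. ext_incl (T_x U) \<and>\<^sub>E ext_incl (T_1 V)"] by simp
qed

lemma d_cy_T_1:
  assumes W: "lyndon W"
  shows "finite {(U, V). lyndon U \<and> lyndon V \<and> U < V \<and> gamma W U V \<noteq> 0}"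
    and "d_cy (T_1 W) =
          (\<Sum>(U, V) | lyndon U \<and> lyndon V \<and> U < V \<and> gamma W U V \<noteq> 0.
            gamma W U V *\<^sub>Q (ext_incl (T_1 U) \<and>\<^sub>E ext_incl (T_1 V)))"
proof -
  let ?P = "lyndon_upto (length W)"
  let ?Lt = "{(U, V). U \<in> ?P \<and> V \<in> ?P \<and> U < V}"
  have fin: "finite ?Lt" by (rule finite_subset[of _ "?P \<times> ?P"]) auto
  have zero: "app_dual (T_1 W) (bracket_1x (basis (False, U)) (basis (s, V))) = 0" for U V s
    by (cases s) (simp_all add: basis_def bracket_1x_x_x bracket_1x_x_1 app_dual_T_1[OF W],
      simp_all add: at_x_def rvp.linear_0[OF linear_lyndon_coord])
  have a: "(U, V) \<in> ?Lt"
    if "(U, V) \<in> {(U, V). lyndon U \<and> lyndon V \<and> U < V}" "gamma W U V \<noteq> 0" for U V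
    using T_bracket_nonzero_length[OF W, of "(True, U)" "(True, V)" True] that
    by (simp add: gamma_eq[OF W] dual_basis_def lyndon_upto_def)
  have sub: "?Lt \<subseteq> {(U, V). lyndon U \<and> lyndon V \<and> U < V}"
    by (auto simp: lyndon_upto_def)
  note gamma = sum_restrict_support[where c = "gamma W", OF fin sub a]
  show "finite {(U, V). lyndon U \<and> lyndon V \<and> U < V \<and> gamma W U V \<noteq> 0}"
    using gamma(1) by simp
  have "d_cy (T_1 W)
    = (\<Sum>(U, V)\<in>?Lt. gamma W U V *\<^sub>Q (ext_incl (T_1 U) \<and>\<^sub>E ext_incl (T_1 V)))"
    using d_cy_dual_basis[OF W, of True] by (simp add: dual_basis_def zero gamma_eq[OF W])
  then show "d_cy (T_1 W) =
          (\<Sum>(U, V) | lyndon U \<and> lyndon V \<and> U < V \<and> gamma W U V \<noteq> 0.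
            gamma W U V *\<^sub>Q (ext_incl (T_1 U) \<and>\<^sub>E ext_incl (T_1 V)))"
    using gamma(2) by simp
qed

theorem proposition4p27:
  shows "(\<forall>\<phi>. \<exists>!\<omega>. is_cobracket \<phi> \<omega>)
    \<and> linearQ d_cy
    \<and> (\<forall>W. lyndon W \<longrightarrow>
        finite {(U, V). lyndon U \<and> lyndon V \<and> U < V \<and> alpha W U V \<noteq> 0}
      \<and> finite {(U, V). lyndon U \<and> lyndon V \<and> beta W U V \<noteq> 0}
      \<and> finite {(U, V). lyndon U \<and> lyndon V \<and> U < V \<and> gamma W U V \<noteq> 0}
      \<and> d_cy (T_x W) =
          (\<Sum>(U, V) | lyndon U \<and> lyndon V \<and> U < V \<and> alpha W U V \<noteq> 0.
            alpha W U V *\<^sub>Q (ext_incl (T_x U) \<and>\<^sub>E ext_incl (T_x V)))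
        + (\<Sum>(U, V) | lyndon U \<and> lyndon V \<and> beta W U V \<noteq> 0.
            beta W U V *\<^sub>Q (ext_incl (T_x U) \<and>\<^sub>E ext_incl (T_1 V)))
      \<and> d_cy (T_1 W) =
          (\<Sum>(U, V) | lyndon U \<and> lyndon V \<and> U < V \<and> gamma W U V \<noteq> 0.
            gamma W U V *\<^sub>Q (ext_incl (T_1 U) \<and>\<^sub>E ext_incl (T_1 V))))
    \<and> (\<exists>!d. leibniz_extension d_cy d)
    \<and> (\<forall>d. leibniz_extension d_cy d \<longrightarrow> (\<forall>\<omega>. d (d \<omega>) = 0))"
proof (intro conjI allI impI)
  show "\<exists>!d. leibniz_extension d_cy d"
    using ex_leibniz_extension[OF linear_d_cy d_cy_ext_power] leibniz_extension_unique by blast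
  show "d (d \<omega>) = 0" if "leibniz_extension d_cy d" for d \<omega>
    by (rule leibniz_extension_square_zero[OF that d_cy_ext_power d_cy_square_zero[OF that]])
qed (use d_cy_T_x d_cy_T_1 ex1_is_cobracket linear_d_cy in \<open>simp_all\<close>)

end
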